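(* Let $b_L,\varepsilon_L>0$ satisfy $b_L\to\infty$, $\varepsilon_L\to0$ as $L\to\infty$, and $b_L\le\varepsilon_LL$ for all sufficiently large $L$. Then, as $L\to\infty$, uniformly over integers $n$ with $b_L\le n\le\varepsilon_LL$, \[ \mathbb P\{N_I(L)=n\}=\frac{\exp\{-L\,J_I(n/L)+D_I(s_{L,n}-1)\}}{\sqrt{2\pi L\bigl(s_{L,n}A_I'(s_{L,n})+s_{L,n}^2A_I''(s_{L,n})\bigr)}}\,(1+o(1)). \] Moreover, uniformly over the same integers, \[ s_{L,n}\sim\frac{n}{L\kappa_I},\qquad L\bigl(s_{L,n}A_I'(s_{L,n})+s_{L,n}^2A_I''(s_{L,n})\bigr)\sim n . \]
   Context: Let $Z_{\mathbb H}$ be the determinantal point process on $\mathbb H=\{z\in\mathbb C:\operatorname{Im}z>0\}$ with correlation kernel $K_{\mathbb H}(z,w)=-\frac{1}{\pi(z-\overline w)^2}$ with respect to planar Lebesgue measure. Fix $I=[\alpha,\beta]$ with $0<\alpha<\beta<\infty$. For $L>0$ let $N_I(L)=\#\bigl(Z_{\mathbb H}\cap([0,L]\times I)\bigr)$, where $[0,L]\times I=\{x+\mathrm iy:0\le x\le L,\ \alpha\le y\le\beta\}$. For $\xi>0$ put $q_I(\xi)=e^{-2\alpha\xi}-e^{-2\beta\xi}$, $\rho_I=\sup_{\xi>0}q_I(\xi)\in(0,1)$, and $\Omega_I=\mathbb C\setminus(-\infty,-\rho_I^{-1}]$ (so $[-1,\infty)\subset\Omega_I$). For $t\in\Omega_I$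 define \[ \mathcal L_I(t)=\frac1{2\pi}\int_0^\infty\log\bigl(1+tq_I(\xi)\bigr)\,\mathrm d\xi, \] where for each $\xi$ the logarithm is the branch, holomorphic in $t\in\Omega_I$, that vanishes at $t=0$. The function $D_I$ is the unique holomorphic function on $\Omega_I$ with $D_I(0)=0$ such that $\log\mathbb E(1+t)^{N_I(L)}=L\mathcal L_I(t)+D_I(t)+o(1)$ as $L\to\infty$, locally uniformly on $\Omega_I$; here $t\mapsto\mathbb E(1+t)^{N_I(L)}$ is zero-free on $\Omega_I$ and the logarithm is its holomorphic branch vanishing at $t=0$ (convention $0^0=1$). $D_I$ is real-valued on $(-\rho_I^{-1},\infty)$. Put \[ \kappa_I=\frac1{2\pi}\int_0^\infty\frac{q_I(\xi)}{1-q_I(\xi)}\,\mathrm d\xi>0,\qquad A_I(s)=\mathcal L_I(s-1)-\mathcal L_I(-1)=\frac1{2\pi}\int_0^\infty\log\Bigl(1+s\frac{q_I(\xi)}{1-q_I(\xi)}\Bigr)\mathrm d\xi,\quad s\ge0, \] and \[ J_I(0)=-\mathcal L_I(-1),\qquad J_I(x)=J_I(0)+\sup_{s>0}\bigl\{x\log s-A_I(s)\bigr\},\quad x\ge0 \] (this is the large-deviation rate function of $N_I(L)/L$). For every $x>0$ the supremum is attained at a unique $s>0$, characterized by $sA_I'(s)=x$. For $L>0$ and an integer $n\ge1$, $s_{L,n}>0$ denotes this point for $x=n/L$, i.e. the unique solution of $s_{L,n}A_I'(s_{L,n})=n/L$. "Uniformly over integers $b_L\le n\le\varepsilon_LL$"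 means that the supremum over all such $n$ of the modulus of the $o(1)$ term tends to $0$ as $L\to\infty$ (vacuous for $L$ with no such integer), and $a_{L,n}\sim c_{L,n}$ means $a_{L,n}=c_{L,n}(1+o(1))$ in this sense. *)

theory Defs
  imports
    "HOL-Probability.Probability"
    "HOL-Complex_Analysis.Complex_Analysis"
    "Jordan_Normal_Form.Determinant"
begin

text \<open>
  Simple point processes on a region \<open>S\<close> of the plane, realised as random locally finite
  subsets of \<open>S\<close>.
\<close>

definition bounded_borel_in :: "complex set \<Rightarrow> complex set \<Rightarrow> bool" where
  "bounded_borel_in S B \<longleftrightarrow> B \<in> sets borel \<and> (\<exists>C. compact C \<and> B \<subseteq> C \<and> C \<subseteq> S)"

definition simple_point_process :: "'w measure \<Rightarrow> complex set \<Rightarrow> ('w \<Rightarrow> complex set) \<Rightarrow> bool" where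
  "simple_point_process M S Z \<longleftrightarrow>
     prob_space M \<and>
     (\<forall>\<omega>\<in>space M. Z \<omega> \<subseteq> S \<and> (\<forall>C. compact C \<and> C \<subseteq> S \<longrightarrow> finite (Z \<omega> \<inter> C))) \<and>
     (\<forall>B. bounded_borel_in S B \<longrightarrow> (\<lambda>\<omega>. card (Z \<omega> \<inter> B)) \<in> measurable M (count_space UNIV))"

text \<open>
  \<open>\<rho>\<close> is a \<open>k\<close>-point correlation function with respect to planar Lebesgue measure: it is the
  density on \<open>S\<^sup>k\<close> of the \<open>k\<close>-th factorial moment measure, whose value on a product
  \<open>B\<^sub>0 \<times> \<dots> \<times> B\<^sub>k\<^sub>-\<^sub>1\<close> is the expected number of tuples of pairwise distinct points of the
  process with \<open>i\<close>-th entry in \<open>B\<^sub>i\<close>.  Tuples are functions on \<open>{..<k}\<close>.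
\<close>

definition correlation_function ::
    "'w measure \<Rightarrow> complex set \<Rightarrow> ('w \<Rightarrow> complex set) \<Rightarrow> nat \<Rightarrow> ((nat \<Rightarrow> complex) \<Rightarrow> real) \<Rightarrow> bool" where
  "correlation_function M S Z k \<rho> \<longleftrightarrow>
     set_borel_measurable (PiM {..<k} (\<lambda>_. lborel)) (PiE {..<k} (\<lambda>_. S)) \<rho> \<and>
     (\<forall>x \<in> PiE {..<k} (\<lambda>_. S). 0 \<le> \<rho> x) \<and>
     (\<forall>B. (\<forall>i<k. bounded_borel_in S (B i)) \<longrightarrow>
        (\<integral>\<^sup>+ \<omega>. of_nat (card {x \<in> PiE {..<k} (\<lambda>i. Z \<omega> \<inter> B i). inj_on x {..<k}}) \<partial>M)
        = (\<integral>\<^sup>+ x. ennreal (\<rho> x) * indicator (PiE {..<k} B) x \<partial>(PiM {..<k} (\<lambda>_. lborel))))"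

definition determinantal_point_process ::
    "'w measure \<Rightarrow> complex set \<Rightarrow> (complex \<Rightarrow> complex \<Rightarrow> complex) \<Rightarrow> ('w \<Rightarrow> complex set) \<Rightarrow> bool" where
  "determinantal_point_process M S K Z \<longleftrightarrow>
     simple_point_process M S Z \<and>
     (\<forall>k. \<exists>\<rho>. correlation_function M S Z k \<rho> \<and>
        (\<forall>x \<in> PiE {..<k} (\<lambda>_. S).
           complex_of_real (\<rho> x) = Determinant.det (mat k k (\<lambda>(i, j). K (x i) (x j)))))"

definition upper_half_plane :: "complex set" where
  "upper_half_plane = {z. 0 < Im z}"

definition K_H :: "complex \<Rightarrow> complex \<Rightarrow> complex" where
  "K_H z w = - 1 / (of_real pi * (z - cnj w)\<^sup>2)"

definition N_I :: "('w \<Rightarrow> complex set) \<Rightarrow> real \<Rightarrow> real \<Rightarrow> real \<Rightarrow> 'w \<Rightarrow> nat" where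
  "N_I Z \<alpha> \<beta> L \<omega> = card (Z \<omega> \<inter> {z. 0 \<le> Re z \<and> Re z \<le> L \<and> \<alpha> \<le> Im z \<and> Im z \<le> \<beta>})"

definition q_I :: "real \<Rightarrow> real \<Rightarrow> real \<Rightarrow> real" where
  "q_I \<alpha> \<beta> \<xi> = exp (- 2 * \<alpha> * \<xi>) - exp (- 2 * \<beta> * \<xi>)"

definition rho_I :: "real \<Rightarrow> real \<Rightarrow> real" where
  "rho_I \<alpha> \<beta> = (SUP \<xi>\<in>{0<..}. q_I \<alpha> \<beta> \<xi>)"

definition Omega_I :: "real \<Rightarrow> real \<Rightarrow> complex set" where
  "Omega_I \<alpha> \<beta> = - (complex_of_real ` {.. - inverse (rho_I \<alpha> \<beta>)})"

text \<open>
  For \<open>t\<close> in \<open>Omega_I \<alpha> \<beta>\<close> and \<open>\<xi> > 0\<close> the number \<open>1 + t q_I(\<xi>)\<close> avoids the cut of the principal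
  logarithm (lemma \<open>Ln_branch_I\<close>), so \<open>Ln (1 + t q_I(\<xi>))\<close> is the branch that is holomorphic
  in \<open>t\<close> and vanishes at \<open>t = 0\<close>.
\<close>

definition L_I :: "real \<Rightarrow> real \<Rightarrow> complex \<Rightarrow> complex" where
  "L_I \<alpha> \<beta> t = 1 / (2 * of_real pi) * (LBINT \<xi>:{0<..}. Ln (1 + t * of_real (q_I \<alpha> \<beta> \<xi>)))"

lemma Ln_branch_I:
  assumes "0 < \<alpha>" "\<alpha> < \<beta>" "0 < \<xi>"
  shows "t \<in> Omega_I \<alpha> \<beta> \<Longrightarrow> 1 + t * of_real (q_I \<alpha> \<beta> \<xi>) \<notin> \<real>\<^sub>\<le>\<^sub>0"
    and "(\<lambda>t. Ln (1 + t * of_real (q_I \<alpha> \<beta> \<xi>))) holomorphic_on Omega_I \<alpha> \<beta>"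
    and "Ln (1 + 0 * of_real (q_I \<alpha> \<beta> \<xi>)) = 0"
proof -
  have q: "0 < q_I \<alpha> \<beta> \<xi>"
    using assms by (simp add: q_I_def)
  have "bdd_above (q_I \<alpha> \<beta> ` {0<..})"
  proof (rule bdd_aboveI2)
    fix x :: real assume "x \<in> {0<..}"
    then have "exp (- 2 * \<alpha> * x) \<le> 1" using assms by simp
    then show "q_I \<alpha> \<beta> x \<le> 1" unfolding q_I_def using exp_gt_zero[of "- 2 * \<beta> * x"] by linarith
  qed
  then have le: "q_I \<alpha> \<beta> \<xi> \<le> rho_I \<alpha> \<beta>"
    unfolding rho_I_def using assms by (intro cSUP_upper) auto
  have *: "1 + t * of_real (q_I \<alpha> \<beta> \<xi>) \<notin> \<real>\<^sub>\<le>\<^sub>0" if t: "t \<in> Omega_I \<alpha> \<beta>" for t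
  proof
    assume "1 + t * of_real (q_I \<alpha> \<beta> \<xi>) \<in> \<real>\<^sub>\<le>\<^sub>0"
    then have im: "Im t = 0" and re: "1 + Re t * q_I \<alpha> \<beta> \<xi> \<le> 0"
      using q by (auto simp: complex_nonpos_Reals_iff)
    from re q have "Re t \<le> - inverse (q_I \<alpha> \<beta> \<xi>)"
      by (simp add: field_simps)
    also have "\<dots> \<le> - inverse (rho_I \<alpha> \<beta>)"
      using q le by (simp add: le_imp_inverse_le)
    finally have "Re t \<in> {.. - inverse (rho_I \<alpha> \<beta>)}" by simp
    moreover have "t = complex_of_real (Re t)" using im by (simp add: complex_eq_iff)
    ultimately show False using t unfolding Omega_I_def by blast
  qed
  show "t \<in> Omega_I \<alpha> \<beta> \<Longrightarrow> 1 + t * of_real (q_I \<alpha> \<beta> \<xi>) \<notin> \<real>\<^sub>\<le>\<^sub>0" by (rule *)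
  show "(\<lambda>t. Ln (1 + t * of_real (q_I \<alpha> \<beta> \<xi>))) holomorphic_on Omega_I \<alpha> \<beta>"
    by (intro holomorphic_intros) (rule *)
  show "Ln (1 + 0 * of_real (q_I \<alpha> \<beta> \<xi>)) = 0" by simp
qed

text \<open>
  \<open>G L\<close> is the branch on \<open>Omega_I \<alpha> \<beta>\<close> of the logarithm of \<open>t \<mapsto> E (1 + t)\<^bsup>N\<^esup>\<close> that vanishes at
  \<open>0\<close>.  The region is connected, so these conditions determine \<open>G L\<close> on it; they entail that
  the expectation is zero-free there.
\<close>

definition is_log_pgf ::
    "'w measure \<Rightarrow> ('w \<Rightarrow> complex set) \<Rightarrow> real \<Rightarrow> real \<Rightarrow> (real \<Rightarrow> complex \<Rightarrow> complex) \<Rightarrow> bool" where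
  "is_log_pgf M Z \<alpha> \<beta> G \<longleftrightarrow>
     (\<forall>L>0. G L holomorphic_on Omega_I \<alpha> \<beta> \<and> G L 0 = 0 \<and>
        (\<forall>t\<in>Omega_I \<alpha> \<beta>. exp (G L t) = (LINT \<omega>|M. (1 + t) ^ N_I Z \<alpha> \<beta> L \<omega>)))"

text \<open>
  The characterisation of the constant-order term \<open>D_I\<close>.  It determines the values of \<open>D\<close> on
  \<open>Omega_I \<alpha> \<beta>\<close>, and only these are ever used.
\<close>

definition is_D_I ::
    "'w measure \<Rightarrow> ('w \<Rightarrow> complex set) \<Rightarrow> real \<Rightarrow> real \<Rightarrow> (complex \<Rightarrow> complex) \<Rightarrow> bool" where
  "is_D_I M Z \<alpha> \<beta> D \<longleftrightarrow>
     D holomorphic_on Omega_I \<alpha> \<beta> \<and> D 0 = 0 \<and>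
     (\<exists>G. is_log_pgf M Z \<alpha> \<beta> G \<and>
        (\<forall>C. compact C \<and> C \<subseteq> Omega_I \<alpha> \<beta> \<longrightarrow>
           uniform_limit C (\<lambda>L t. G L t - of_real L * L_I \<alpha> \<beta> t) D at_top))"

definition kappa_I :: "real \<Rightarrow> real \<Rightarrow> real" where
  "kappa_I \<alpha> \<beta> = 1 / (2 * pi) * (LBINT \<xi>:{0<..}. q_I \<alpha> \<beta> \<xi> / (1 - q_I \<alpha> \<beta> \<xi>))"

text \<open>
  The values of \<open>L_I\<close> on \<open>[-1,\<infinity>)\<close> are real, so \<open>Re\<close> is only a change of type in the next two
  definitions.
\<close>

definition A_I :: "real \<Rightarrow> real \<Rightarrow> real \<Rightarrow> real" where
  "A_I \<alpha> \<beta> s = Re (L_I \<alpha> \<beta> (of_real (s - 1)) - L_I \<alpha> \<beta> (- 1))"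

definition J_I :: "real \<Rightarrow> real \<Rightarrow> real \<Rightarrow> real" where
  "J_I \<alpha> \<beta> x = - Re (L_I \<alpha> \<beta> (- 1)) + (SUP s\<in>{0<..}. x * ln s - A_I \<alpha> \<beta> s)"

definition saddle :: "real \<Rightarrow> real \<Rightarrow> real \<Rightarrow> nat \<Rightarrow> real" where
  "saddle \<alpha> \<beta> L n = (THE s. 0 < s \<and> s * deriv (A_I \<alpha> \<beta>) s = real n / L)"

definition V_I :: "real \<Rightarrow> real \<Rightarrow> real \<Rightarrow> real" where
  "V_I \<alpha> \<beta> s = s * deriv (A_I \<alpha> \<beta>) s + s\<^sup>2 * (deriv ^^ 2) (A_I \<alpha> \<beta>) s"

definition window :: "(real \<Rightarrow> real) \<Rightarrow> (real \<Rightarrow> real) \<Rightarrow> real \<Rightarrow> nat set" where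
  "window b \<epsilon> L = {n. b L \<le> real n \<and> real n \<le> \<epsilon> L * L}"

text \<open>
  \<open>sup\<^bsub>n \<in> W L\<^esub> |e L n| \<rightarrow> 0\<close> as \<open>L \<rightarrow> \<infinity>\<close>, written out so that it is vacuous whenever
  \<open>W L\<close> is empty.
\<close>

definition uniformly_o1 :: "(real \<Rightarrow> nat set) \<Rightarrow> (real \<Rightarrow> nat \<Rightarrow> real) \<Rightarrow> bool" where
  "uniformly_o1 W e \<longleftrightarrow> (\<forall>\<delta>>0. \<forall>\<^sub>F L in at_top. \<forall>n\<in>W L. \<bar>e L n\<bar> \<le> \<delta>)"

definition uniformly_asymp ::
    "(real \<Rightarrow> nat set) \<Rightarrow> (real \<Rightarrow> nat \<Rightarrow> real) \<Rightarrow> (real \<Rightarrow> nat \<Rightarrow> real) \<Rightarrow> bool" where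
  "uniformly_asymp W a c \<longleftrightarrow>
     (\<exists>e. uniformly_o1 W e \<and> (\<forall>\<^sub>F L in at_top. \<forall>n\<in>W L. a L n = c L n * (1 + e L n)))"

end

theory Submission
  imports Defs
begin

text \<open>
  The proof is a saddle-point analysis of the probability generating function on a small circle
  around \<open>0\<close>. Put \<open>s = 1 + t\<close>. The hypothesis on \<open>D\<close> says that
  \<open>E s\<^sup>N = exp (L L_I(s - 1) + D(s - 1) + o(1))\<close> on compact subsets of the region, and a disc around
  \<open>s = 0\<close> is such a subset. It remains to pass from this
  generating function to its individual coefficients.

  The coefficient formula (\<open>prob_eq_circle_integral\<close>) writes \<open>2 \<pi> s\<^sup>n P(N = n)\<close> as
  the integral of \<open>E (s e\<^sup>i\<^sup>\<theta>)\<^sup>N e\<^sup>-\<^sup>i\<^sup>n\<^sup>\<theta>\<close> over the circle of radius \<open>s\<close>;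
  from here on \<open>s\<close> is the saddle point for \<open>n / L\<close>. Because \<open>n / L \<rightarrow> 0\<close>, the saddle point tends to \<open>0\<close>, and near \<open>0\<close> the
  function \<open>A(s) = L_I(s - 1) - L_I(-1)\<close> is nearly linear. Subtracting its Taylor polynomial of
  degree one at the saddle point, whose linear term contributes exactly
  \<open>L s A'(s) (e\<^sup>i\<^sup>\<theta> - 1) = n (e\<^sup>i\<^sup>\<theta> - 1)\<close>, shows that the exponent differs from the Poisson phase
  \<open>n (e\<^sup>i\<^sup>\<theta> - 1 - i\<theta>)\<close> by at most \<open>n \<delta> \<theta>\<^sup>2 + \<eta>\<close> with \<open>\<delta>, \<eta> \<rightarrow> 0\<close>. For such
  exponents the integral is \<open>sqrt (2 \<pi> / n) (1 + o(1))\<close> (\<open>laplace_poisson_phase\<close>), on the whole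
  circle and not only near \<open>\<theta> = 0\<close>, since the real part of the Poisson phase is at most
  \<open>- n \<theta>\<^sup>2 / 24\<close> throughout. So the points away from the saddle need no separate estimate.

  The prefactor \<open>exp (L L_I(s - 1) + D(s - 1)) / s\<^sup>n\<close> has modulus
  \<open>exp (- L J_I(n / L) + Re D(s - 1))\<close> because the supremum defining \<open>J_I\<close> is attained at the saddle
  point (\<open>J_I_eq\<close>). Comparing moduli suffices, as the probability is nonnegative.
  Finally \<open>A'(s) \<rightarrow> A'(0) = \<kappa>\<close> gives both remaining equivalences (\<open>saddle_sequence\<close>).

  Uniformity in \<open>n\<close> is handled by proving all limits along arbitrary sequences \<open>(L\<^sub>k, n\<^sub>k)\<close> in the
  window (\<open>uniformly_asympI\<close>), which makes dominated convergence available.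
\<close>

section \<open>Uniform statements and sequences\<close>

text \<open>
  A failure of uniformity at level \<open>\<delta>\<close> would provide, for every \<open>k\<close>, some \<open>L \<ge> k\<close> and
  \<open>n \<in> W L\<close> violating the bound, hence a sequence contradicting the assumption. Division by zero
  is harmless: a quotient with \<open>c = 0\<close> equals \<open>0\<close>, which is not close to \<open>1\<close>.
\<close>

lemma uniformly_asympI:
  assumes lim: "\<And>X m. filterlim X at_top sequentially \<Longrightarrow> (\<And>k. m k \<in> W (X k)) \<Longrightarrow>
                 (\<lambda>k. a (X k) (m k) / c (X k) (m k)) \<longlonglongrightarrow> 1"
  shows "uniformly_asymp W a c"
proof -
  have ev: "\<forall>\<^sub>F L in at_top. \<forall>n\<in>W L. \<bar>a L n / c L n - 1\<bar> \<le> \<delta>" if "\<delta> > 0" for \<delta> :: real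
  proof (rule ccontr)
    assume "\<not> ?thesis"
    then have "\<exists>L n. real k \<le> L \<and> n \<in> W L \<and> \<delta> < \<bar>a L n / c L n - 1\<bar>" for k
      unfolding eventually_at_top_linorder by (metis not_le)
    then obtain X m where Xm: "\<And>k. real k \<le> X k" "\<And>k. m k \<in> W (X k)"
        "\<And>k. \<delta> < \<bar>a (X k) (m k) / c (X k) (m k) - 1\<bar>"
      by metis
    have "filterlim X at_top sequentially"
      by (rule filterlim_at_top_mono[OF filterlim_real_sequentially]) (use Xm(1) in auto)
    from lim[OF this Xm(2)] have "\<forall>\<^sub>F k in sequentially. dist (a (X k) (m k) / c (X k) (m k)) 1 < \<delta>"
      using \<open>\<delta> > 0\<close> by (rule tendstoD)
    then obtain k where "dist (a (X k) (m k) / c (X k) (m k)) 1 < \<delta>"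
      by (auto simp: eventually_sequentially)
    with Xm(3)[of k] show False by (simp add: dist_real_def)
  qed
  have "\<forall>\<^sub>F L in at_top. \<forall>n\<in>W L. a L n = c L n * (1 + (a L n / c L n - 1))"
    using ev[of "1/2", simplified]
  proof eventually_elim
    case (elim L)
    show ?case
    proof
      fix n assume "n \<in> W L"
      with elim have "c L n \<noteq> 0" by fastforce
      then show "a L n = c L n * (1 + (a L n / c L n - 1))" by simp
    qed
  qed
  then show ?thesis
    unfolding uniformly_asymp_def uniformly_o1_def using ev
    by (intro exI[of _ "\<lambda>L n. a L n / c L n - 1"]) auto
qed

text \<open>
  The rate is the supremum of the distances over \<open>C\<close>. It turns the two-quantifier form of uniform
  convergence into a null sequence that can be used in error bounds.
\<close>

lemma uniform_limit_rate:
  assumes lim: "uniform_limit C f g F" and C: "C \<noteq> {}"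
  obtains \<eta> :: "'b \<Rightarrow> real" where "(\<eta> \<longlongrightarrow> 0) F" "\<forall>\<^sub>F n in F. \<forall>x\<in>C. dist (f n x) (g x) \<le> \<eta> n"
proof
  let ?\<eta> = "\<lambda>n. SUP x\<in>C. dist (f n x) (g x)"
  obtain c where c: "c \<in> C" using C by blast
  have le: "\<forall>\<^sub>F n in F. (\<forall>x\<in>C. dist (f n x) (g x) \<le> ?\<eta> n) \<and> ?\<eta> n \<le> e" if "e > 0" for e
    using uniform_limitD[OF lim that]
  proof eventually_elim
    case (elim n)
    then have bdd: "bdd_above ((\<lambda>x. dist (f n x) (g x)) ` C)"
      by (intro bdd_aboveI2[where M = e]) (auto intro: less_imp_le)
    show ?case
    proof (intro conjI ballI)
      show "dist (f n x) (g x) \<le> ?\<eta> n" if "x \<in> C" for x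
        using that bdd by (rule cSUP_upper)
      show "?\<eta> n \<le> e"
        using C elim by (intro cSUP_least) (auto intro: less_imp_le)
    qed
  qed
  show "\<forall>\<^sub>F n in F. \<forall>x\<in>C. dist (f n x) (g x) \<le> ?\<eta> n"
    using le[of 1] by (auto elim: eventually_mono)
  show "(?\<eta> \<longlongrightarrow> 0) F"
  proof (rule tendstoI)
    fix e :: real assume e: "e > 0"
    then have "0 < e / 2" by simp
    from le[OF this] show "\<forall>\<^sub>F n in F. dist (?\<eta> n) 0 < e"
    proof eventually_elim
      case (elim n)
      have "0 \<le> dist (f n c) (g c)" by simp
      also have "\<dots> \<le> ?\<eta> n" using elim c by blast
      finally have "0 \<le> ?\<eta> n" .
      then show ?case using elim e by (simp add: dist_real_def)
    qed
  qed
qed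

section \<open>Laplace asymptotics for exponents close to a Poisson phase\<close>

text \<open>
  The Taylor bound \<open>cos x \<le> 1 - x\<^sup>2/2 + x\<^sup>4/24\<close> suffices on the whole interval because
  \<open>\<pi>\<^sup>2 < 11 < 12\<close>; the coefficient \<open>1/2 - 11/24\<close> is \<open>1/24\<close>.
\<close>

lemma cos_le_quadratic:
  fixes x :: real
  assumes "\<bar>x\<bar> \<le> pi"
  shows "cos x - 1 \<le> - x\<^sup>2 / 24"
proof -
  have "\<bar>Re (iexp x - (\<Sum>k\<le>3. (\<i> * x) ^ k / fact k))\<bar> \<le> \<bar>x\<bar> ^ Suc 3 / fact (Suc 3)"
    using iexp_approx1[of x 3] abs_Re_le_cmod order_trans by blast
  then have 1: "cos x - 1 + x\<^sup>2 / 2 \<le> x\<^sup>2 * x\<^sup>2 / 24"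
    by (auto simp: numeral_eq_Suc power2_eq_square Re_exp fact_numeral abs_le_iff abs_if split: if_splits)
  have "x\<^sup>2 \<le> pi\<^sup>2" using assms by (metis abs_le_square_iff abs_of_pos pi_gt_zero)
  also have "pi\<^sup>2 \<le> (33/10)\<^sup>2" by (rule power_mono) (use pi_approx in auto)
  finally have "x\<^sup>2 \<le> 11" by (simp add: power2_eq_square)
  then have "x\<^sup>2 * x\<^sup>2 \<le> 11 * x\<^sup>2" by (intro mult_right_mono) auto
  with 1 show ?thesis by simp
qed

lemma integrable_exp_neg_square:
  fixes c :: real
  assumes "0 < c"
  shows "integrable lborel (\<lambda>x. exp (a - c * x\<^sup>2))"
proof -
  let ?s = "sqrt (1 / (2 * c))"
  have s: "?s > 0" using assms by simp
  have "integrable lborel (\<lambda>x. exp a * sqrt (2 * pi * ?s\<^sup>2) * normal_density 0 ?s x)"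
    by (rule integrable_mult_right) (rule integrable_normal_density[OF s])
  moreover have "exp a * sqrt (2 * pi * ?s\<^sup>2) * normal_density 0 ?s x = exp (a - c * x\<^sup>2)" for x
    using assms by (simp add: normal_density_def exp_diff exp_minus field_simps real_sqrt_mult[symmetric])
  ultimately show ?thesis by simp
qed

lemma integral_gaussian: "(LBINT x. complex_of_real (exp (- x\<^sup>2 / 2))) = sqrt (2 * pi)"
proof -
  have "(LBINT x. exp (- x\<^sup>2 / 2)) = (LBINT x. sqrt (2 * pi) * std_normal_density x)"
    by (simp add: std_normal_density_def)
  also have "\<dots> = sqrt (2 * pi)" by simp
  finally show ?thesis by (simp del: of_real_exp)
qed

text \<open>
  After the substitution \<open>\<theta> = u / sqrt N\<close> the integrand converges pointwise to \<open>exp (- u\<^sup>2/2)\<close>. By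
  the bound on the cosine, as soon as \<open>\<delta> < 1/48\<close> and \<open>\<eta> < 1\<close> it is dominated by
  \<open>exp (1 - u\<^sup>2/48)\<close>, with no restriction to small angles.
\<close>

lemma laplace_poisson_phase:
  fixes \<Phi> :: "nat \<Rightarrow> real \<Rightarrow> complex" and N \<delta> \<eta> :: "nat \<Rightarrow> real"
  assumes N: "filterlim N at_top sequentially" and \<delta>: "\<delta> \<longlonglongrightarrow> 0" and \<eta>: "\<eta> \<longlonglongrightarrow> 0"
    and cont: "\<forall>\<^sub>F k in sequentially. continuous_on {-pi..pi} (\<Phi> k)"
    and bound: "\<forall>\<^sub>F k in sequentially. \<forall>\<theta>\<in>{-pi..pi}.
          cmod (\<Phi> k \<theta> - of_real (N k) * (iexp \<theta> - 1 - \<i> * \<theta>)) \<le> N k * \<delta> k * \<theta>\<^sup>2 + \<eta> k"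
  shows "(\<lambda>k. sqrt (N k) * (LBINT \<theta>:{-pi..pi}. exp (\<Phi> k \<theta>))) \<longlonglongrightarrow> complex_of_real (sqrt (2 * pi))"
proof -
  define f where "f k u = indicator {-pi..pi} (u / sqrt (N k)) *\<^sub>R exp (\<Phi> k (u / sqrt (N k)))" for k u
  have "\<forall>\<^sub>F k in sequentially. N k > 1" using N by (simp add: filterlim_at_top_dense)
  moreover have "\<forall>\<^sub>F k in sequentially. \<delta> k < 1/48" using \<delta> by (rule order_tendstoD) simp
  moreover have "\<forall>\<^sub>F k in sequentially. \<eta> k < 1" using \<eta> by (rule order_tendstoD) simp
  ultimately have "\<forall>\<^sub>F k in sequentially. N k > 1 \<and> \<delta> k < 1/48 \<and> \<eta> k < 1 \<and> continuous_on {-pi..pi} (\<Phi> k) \<and>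
      (\<forall>\<theta>\<in>{-pi..pi}. cmod (\<Phi> k \<theta> - of_real (N k) * (iexp \<theta> - 1 - \<i> * \<theta>)) \<le> N k * \<delta> k * \<theta>\<^sup>2 + \<eta> k)"
    using cont bound by eventually_elim auto
  then obtain K where K: "\<And>k. k \<ge> K \<Longrightarrow> N k > 1" "\<And>k. k \<ge> K \<Longrightarrow> \<delta> k < 1/48" "\<And>k. k \<ge> K \<Longrightarrow> \<eta> k < 1"
      "\<And>k. k \<ge> K \<Longrightarrow> continuous_on {-pi..pi} (\<Phi> k)"
      "\<And>k \<theta>. k \<ge> K \<Longrightarrow> \<theta> \<in> {-pi..pi} \<Longrightarrow>
         cmod (\<Phi> k \<theta> - of_real (N k) * (iexp \<theta> - 1 - \<i> * \<theta>)) \<le> N k * \<delta> k * \<theta>\<^sup>2 + \<eta> k"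
    unfolding eventually_sequentially by blast
  have lim: "(\<lambda>k. f k u) \<longlonglongrightarrow> of_real (exp (- u\<^sup>2 / 2))" for u
  proof -
    have N0: "(\<lambda>k. u / sqrt (N k)) \<longlonglongrightarrow> 0"
      by (intro real_tendsto_divide_at_top[OF tendsto_const] filterlim_compose[OF sqrt_at_top N])
    have ev: "\<forall>\<^sub>F k in sequentially. u / sqrt (N k) \<in> {-pi<..<pi}"
      using N0 by (rule topological_tendstoD) auto
    have 1: "(\<lambda>k. \<Phi> k (u / sqrt (N k)) - of_real (N k) * (iexp (u / sqrt (N k)) - 1 - \<i> * (u / sqrt (N k)))) \<longlonglongrightarrow> 0"
    proof (rule Lim_null_comparison)
      show "\<forall>\<^sub>F k in sequentially. cmod (\<Phi> k (u / sqrt (N k)) - of_real (N k) * (iexp (u / sqrt (N k)) - 1 - \<i> * (u / sqrt (N k))))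
              \<le> \<delta> k * u\<^sup>2 + \<eta> k"
        using ev eventually_ge_at_top[of K]
      proof eventually_elim
        case (elim k)
        have "N k * \<delta> k * (u / sqrt (N k))\<^sup>2 = \<delta> k * u\<^sup>2"
          using K(1)[of k] elim by (simp add: power_divide)
        with K(5)[of k "u / sqrt (N k)"] elim show ?case by simp
      qed
      show "(\<lambda>k. \<delta> k * u\<^sup>2 + \<eta> k) \<longlonglongrightarrow> 0"
        using tendsto_add[OF tendsto_mult_right[OF \<delta>, of "u\<^sup>2"] \<eta>] by simp
    qed
    have 2: "(\<lambda>k. of_real (N k) * (iexp (u / sqrt (N k)) - 1 - \<i> * (u / sqrt (N k))) - (- u\<^sup>2 / 2)) \<longlonglongrightarrow> (0::complex)"
    proof (rule Lim_null_comparison)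
      show "\<forall>\<^sub>F k in sequentially. cmod (of_real (N k) * (iexp (u / sqrt (N k)) - 1 - \<i> * (u / sqrt (N k))) - (- u\<^sup>2 / 2))
              \<le> \<bar>u\<bar> ^ 3 / sqrt (N k)"
        using eventually_ge_at_top[of K]
      proof eventually_elim
        case (elim k)
        let ?y = "u / sqrt (N k)"
        have Np: "N k > 1" using K(1) elim by auto
        have taylor: "iexp y - (\<Sum>j\<le>2. (\<i> * y) ^ j / fact j) = iexp y - 1 - \<i> * y + y\<^sup>2 / 2" for y :: real
          by (simp add: numeral_eq_Suc power2_eq_square algebra_simps)
        have "\<bar>?y\<bar> ^ Suc 2 / fact (Suc 2) \<le> \<bar>?y\<bar> ^ 3 / 1"
          by (intro frac_le) (auto simp del: fact_Suc)
        with iexp_approx1[of ?y 2] have b: "cmod (iexp ?y - 1 - \<i> * ?y + ?y\<^sup>2 / 2) \<le> \<bar>?y\<bar> ^ 3"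
          unfolding taylor by linarith
        have "of_real (N k) * (iexp ?y - 1 - \<i> * ?y) - (- u\<^sup>2 / 2) = of_real (N k) * (iexp ?y - 1 - \<i> * ?y + ?y\<^sup>2 / 2)"
        proof -
          have "complex_of_real (N k) * ?y\<^sup>2 = of_real (N k * (?y\<^sup>2))" by simp
          also have "N k * ?y\<^sup>2 = u\<^sup>2" using Np by (simp add: power_divide)
          finally show ?thesis by (simp add: algebra_simps)
        qed
        then have "cmod (of_real (N k) * (iexp ?y - 1 - \<i> * ?y) - (- u\<^sup>2 / 2)) = N k * cmod (iexp ?y - 1 - \<i> * ?y + ?y\<^sup>2 / 2)"
          using Np by (simp add: norm_mult)
        also have "\<dots> \<le> N k * \<bar>?y\<bar> ^ 3" using b Np by (intro mult_left_mono) auto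
        also have "\<dots> = \<bar>u\<bar> ^ 3 / sqrt (N k)"
        proof -
          have "N k = sqrt (N k) * sqrt (N k)" using Np by simp
          then show ?thesis using Np by (simp add: abs_divide power_divide power3_eq_cube field_simps)
        qed
        finally show ?case .
      qed
      show "(\<lambda>k. \<bar>u\<bar> ^ 3 / sqrt (N k)) \<longlonglongrightarrow> 0"
        by (intro real_tendsto_divide_at_top[OF tendsto_const] filterlim_compose[OF sqrt_at_top N])
    qed
    have "(\<lambda>k. \<Phi> k (u / sqrt (N k))) \<longlonglongrightarrow> complex_of_real (- u\<^sup>2 / 2)"
      using tendsto_add[OF tendsto_add[OF 1 2] tendsto_const[of "complex_of_real (- u\<^sup>2 / 2)"]] by simp
    then have "(\<lambda>k. exp (\<Phi> k (u / sqrt (N k)))) \<longlonglongrightarrow> exp (complex_of_real (- u\<^sup>2 / 2))"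
      by (rule tendsto_exp)
    moreover have "\<forall>\<^sub>F k in sequentially. f k u = exp (\<Phi> k (u / sqrt (N k)))"
      using ev by eventually_elim (auto simp: f_def)
    ultimately show ?thesis
      by (subst tendsto_cong) (simp_all only: exp_of_real)
  qed
  have meas: "f k \<in> borel_measurable lborel" if "k \<ge> K" for k
  proof -
    have "(\<lambda>\<theta>. indicator {-pi..pi} \<theta> *\<^sub>R exp (\<Phi> k \<theta>)) \<in> borel_measurable borel"
      by (intro borel_measurable_continuous_on_indicator continuous_intros K that) auto
    from measurable_compose[OF _ this, of "\<lambda>u. u / sqrt (N k)" borel]
    show ?thesis by (simp add: f_def[abs_def])
  qed
  have bd: "norm (f k u) \<le> exp (1 - (1/48) * u\<^sup>2)" if k: "k \<ge> K" for k u
  proof (cases "u / sqrt (N k) \<in> {-pi..pi}")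
    case True
    let ?y = "u / sqrt (N k)"
    have Np: "N k > 1" using K(1) k by auto
    have y: "\<bar>?y\<bar> \<le> pi" using True by auto
    have "Re (\<Phi> k ?y - of_real (N k) * (iexp ?y - 1 - \<i> * ?y)) \<le> N k * \<delta> k * ?y\<^sup>2 + \<eta> k"
      using K(5)[OF k True] complex_Re_le_cmod order_trans by blast
    then have "Re (\<Phi> k ?y) \<le> N k * (cos ?y - 1) + N k * ?y\<^sup>2 * \<delta> k + \<eta> k"
      by (simp add: Re_exp algebra_simps)
    also have "\<dots> \<le> N k * (- ?y\<^sup>2 / 24) + N k * ?y\<^sup>2 * (1/48) + 1"
      using K(2,3)[OF k] Np cos_le_quadratic[OF y]
      by (intro add_mono mult_left_mono mult_nonneg_nonneg) auto
    also have "\<dots> = 1 - (1/48) * (N k * ?y\<^sup>2)" by simp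
    also have "N k * ?y\<^sup>2 = u\<^sup>2" using Np by (simp add: power_divide)
    finally show ?thesis using True by (simp add: f_def)
  qed (simp add: f_def)
  have "(\<lambda>k. LBINT u. f (k + K) u) \<longlonglongrightarrow> (LBINT u. complex_of_real (exp (- u\<^sup>2 / 2)))"
  proof (rule integral_dominated_convergence)
    show "integrable lborel (\<lambda>u::real. exp (1 - (1/48) * u\<^sup>2))" by (rule integrable_exp_neg_square) simp
    show "AE u in lborel. (\<lambda>k. f (k + K) u) \<longlonglongrightarrow> complex_of_real (exp (- u\<^sup>2 / 2))"
      using lim by (intro AE_I2 LIMSEQ_ignore_initial_segment) auto
  qed (use meas bd in auto)
  then have "(\<lambda>k. LBINT u. f (k + K) u) \<longlonglongrightarrow> complex_of_real (sqrt (2 * pi))"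
    by (simp only: integral_gaussian)
  moreover have "(LBINT u. f (k + K) u) = sqrt (N (k + K)) * (LBINT \<theta>:{-pi..pi}. exp (\<Phi> (k + K) \<theta>))" for k
  proof -
    have Np: "N (k + K) > 1" using K(1) by auto
    have "(LBINT u. f (k + K) u) = \<bar>sqrt (N (k + K))\<bar> *\<^sub>R (LBINT x. f (k + K) (0 + sqrt (N (k + K)) * x))"
      by (rule lborel_integral_real_affine) (use Np in auto)
    then show ?thesis using Np by (simp add: f_def set_lebesgue_integral_def scaleR_conv_of_real)
  qed
  ultimately have "(\<lambda>k. sqrt (N (k + K)) * (LBINT \<theta>:{-pi..pi}. exp (\<Phi> (k + K) \<theta>))) \<longlonglongrightarrow> complex_of_real (sqrt (2 * pi))"
    by simp
  then show ?thesis by (rule LIMSEQ_offset)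
qed

section \<open>Point probabilities as circle integrals\<close>

lemma integral_iexp_int:
  fixes m :: int
  shows "(LBINT \<theta>:{-pi..pi}. iexp (of_int m * \<theta>)) = (if m = 0 then 2 * pi else 0)"
proof (cases "m = 0")
  case True
  then show ?thesis by (simp add: set_lebesgue_integral_def scaleR_conv_of_real measure_def)
next
  case False
  let ?F = "\<lambda>\<theta>. iexp (of_int m * \<theta>) / (\<i> * of_int m)"
  have "(LBINT \<theta>:{-pi..pi}. iexp (of_int m * \<theta>)) = ?F pi - ?F (-pi)"
    unfolding set_lebesgue_integral_def
  proof (rule integral_FTC_Icc)
    fix x :: real assume "- pi \<le> x" "x \<le> pi"
    show "(?F has_vector_derivative iexp (of_int m * x)) (at x within {- pi..pi})"
      using False by (auto intro!: derivative_eq_intros has_vector_derivative_real_field simp: field_simps)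
  qed (auto intro!: continuous_intros)
  also have "\<dots> = 0"
  proof -
    have "iexp (of_int m * pi) = iexp (of_int m * (-pi))"
      unfolding exp_eq by (intro exI[of _ m]) (simp add: algebra_simps)
    then show ?thesis by simp
  qed
  finally show ?thesis using False by simp
qed

text \<open>
  By Fubini the frequencies \<open>X - n\<close> are integrated out first, and only the event \<open>X = n\<close> survives.
  The radius is at most \<open>1\<close> so that the integrand is bounded.
\<close>

lemma (in prob_space) prob_eq_circle_integral:
  fixes X :: "'a \<Rightarrow> nat"
  assumes X [measurable]: "X \<in> measurable M (count_space UNIV)" and s: "0 \<le> s" "s \<le> 1"
  shows "(LBINT \<theta>:{-pi..pi}. expectation (\<lambda>\<omega>. (of_real s * iexp \<theta>) ^ X \<omega>) * iexp (- (real n * \<theta>)))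
         = complex_of_real (2 * pi * s ^ n * prob {\<omega> \<in> space M. X \<omega> = n})"
proof -
  interpret P: pair_sigma_finite M lborel by standard
  let ?f = "\<lambda>\<omega> \<theta>. indicator {-pi..pi} \<theta> *\<^sub>R ((complex_of_real s * iexp \<theta>) ^ X \<omega> * iexp (- (real n * \<theta>)))"
  have int: "integrable (M \<Otimes>\<^sub>M lborel) (case_prod ?f)"
  proof (rule integrableI_bounded_set[where B=1 and A="space M \<times> {-pi..pi}"])
    show "emeasure (M \<Otimes>\<^sub>M lborel) (space M \<times> {-pi..pi}) < \<infinity>"
      by (subst lborel.emeasure_pair_measure_Times) (auto simp: emeasure_space_1)
    show "AE x\<in>space M \<times> {-pi..pi} in M \<Otimes>\<^sub>M lborel. norm (case_prod ?f x) \<le> 1"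
      using s by (auto simp: norm_mult norm_power power_le_one split: split_indicator)
    show "AE x in M \<Otimes>\<^sub>M lborel. x \<notin> space M \<times> {-pi..pi} \<longrightarrow> case_prod ?f x = 0"
      by (intro AE_I2) (auto simp: space_pair_measure indicator_def split: if_splits)
  qed (auto split: split_indicator)
  have "(LBINT \<theta>:{-pi..pi}. expectation (\<lambda>\<omega>. (of_real s * iexp \<theta>) ^ X \<omega>) * iexp (- (real n * \<theta>)))
        = (LBINT \<theta>. expectation (\<lambda>\<omega>. ?f \<omega> \<theta>))"
    unfolding set_lebesgue_integral_def by (intro Bochner_Integration.integral_cong) (auto split: split_indicator)
  also have "\<dots> = expectation (\<lambda>\<omega>. LBINT \<theta>. ?f \<omega> \<theta>)"
    by (rule P.Fubini_integral[OF int])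
  also have "\<dots> = expectation (\<lambda>\<omega>. complex_of_real (2 * pi * s ^ n * indicator {\<omega> \<in> space M. X \<omega> = n} \<omega>))"
  proof (rule Bochner_Integration.integral_cong)
    fix \<omega> assume \<omega>: "\<omega> \<in> space M"
    have "(complex_of_real s * iexp \<theta>) ^ X \<omega> * iexp (- (real n * \<theta>))
          = of_real s ^ X \<omega> * iexp (of_int (int (X \<omega>) - int n) * \<theta>)" for \<theta>
      by (simp add: power_mult_distrib exp_of_nat_mult[symmetric] exp_add[symmetric] algebra_simps)
    then have "(LBINT \<theta>. ?f \<omega> \<theta>) = (LBINT \<theta>:{-pi..pi}. of_real s ^ X \<omega> * iexp (of_int (int (X \<omega>) - int n) * \<theta>))"
      by (simp only: set_lebesgue_integral_def)
    also have "\<dots> = complex_of_real s ^ X \<omega> * complex_of_real (if int (X \<omega>) - int n = 0 then 2 * pi else 0)"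
      by (simp only: set_integral_mult_right integral_iexp_int)
    finally show "(LBINT \<theta>. ?f \<omega> \<theta>) = complex_of_real (2 * pi * s ^ n * indicator {\<omega> \<in> space M. X \<omega> = n} \<omega>)"
      using \<omega> by auto
  qed simp
  also have "\<dots> = complex_of_real (expectation (\<lambda>\<omega>. 2 * pi * s ^ n * indicator {\<omega> \<in> space M. X \<omega> = n} \<omega>))"
    by (rule integral_complex_of_real)
  also have "expectation (\<lambda>\<omega>. 2 * pi * s ^ n * indicator {\<omega> \<in> space M. X \<omega> = n} \<omega>)
      = 2 * pi * s ^ n * prob {\<omega> \<in> space M. X \<omega> = n}"
    by simp
  finally show ?thesis .
qed

section \<open>Holomorphy of the limiting cumulant generating function\<close>

text \<open>
  Difference quotients are bounded by \<open>w\<close> through the mean value inequality on the convex set \<open>U\<close>,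
  so dominated convergence applies along every sequence tending to \<open>z\<close>.
\<close>

lemma has_field_derivative_integral_dominated:
  fixes f f' :: "complex \<Rightarrow> 'b \<Rightarrow> complex"
  assumes U: "open U" "convex U" "z \<in> U"
    and der: "\<And>y x. y \<in> U \<Longrightarrow> x \<in> space M \<Longrightarrow> ((\<lambda>y. f y x) has_field_derivative f' y x) (at y)"
    and bound: "\<And>y x. y \<in> U \<Longrightarrow> x \<in> space M \<Longrightarrow> norm (f' y x) \<le> w x"
    and f: "\<And>y. y \<in> U \<Longrightarrow> integrable M (f y)" and w: "integrable M w"
    and f': "f' z \<in> borel_measurable M"
  shows "((\<lambda>y. LINT x|M. f y x) has_field_derivative (LINT x|M. f' z x)) (at z)"
proof -
  have "((\<lambda>y. ((LINT x|M. f y x) - (LINT x|M. f z x)) / (y - z)) \<longlongrightarrow> (LINT x|M. f' z x)) (at z within U)"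
    unfolding tendsto_at_iff_sequentially comp_def
  proof (intro allI impI)
    fix X assume X: "\<forall>i. X i \<in> U - {z}" and lim: "X \<longlonglongrightarrow> z"
    have "(\<lambda>i. LINT x|M. (f (X i) x - f z x) / (X i - z)) \<longlonglongrightarrow> (LINT x|M. f' z x)"
    proof (rule integral_dominated_convergence[OF f' _ w])
      show "AE x in M. (\<lambda>i. (f (X i) x - f z x) / (X i - z)) \<longlonglongrightarrow> f' z x"
      proof (rule AE_I2)
        fix x assume "x \<in> space M"
        then have "((\<lambda>y. (f y x - f z x) / (y - z)) \<longlongrightarrow> f' z x) (at z within U)"
          using der[OF U(3)] by (simp add: at_within_open[OF U(3,1)] has_field_derivative_iff)
        then show "(\<lambda>i. (f (X i) x - f z x) / (X i - z)) \<longlonglongrightarrow> f' z x"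
          unfolding tendsto_at_iff_sequentially comp_def using X lim by blast
      qed
      show "AE x in M. norm ((f (X i) x - f z x) / (X i - z)) \<le> w x" for i
      proof (rule AE_I2)
        fix x assume x: "x \<in> space M"
        have "norm (f (X i) x - f z x) \<le> w x * norm (X i - z)"
          using X U(3) by (intro field_differentiable_bound[OF U(2) has_field_derivative_at_within[OF der[OF _ x]] bound[OF _ x]]) auto
        then show "norm ((f (X i) x - f z x) / (X i - z)) \<le> w x"
          using X by (simp add: norm_divide divide_le_eq)
      qed
      show "(\<lambda>x. (f (X i) x - f z x) / (X i - z)) \<in> borel_measurable M" for i
        using X U f[THEN borel_measurable_integrable] by auto
    qed
    moreover have "(LINT x|M. (f (X i) x - f z x) / (X i - z)) = ((LINT x|M. f (X i) x) - (LINT x|M. f z x)) / (X i - z)" for i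
      using X U by (subst integral_divide_zero) (simp add: f)
    ultimately show "(\<lambda>i. ((LINT x|M. f (X i) x) - (LINT x|M. f z x)) / (X i - z)) \<longlonglongrightarrow> (LINT x|M. f' z x)"
      by (simp only:)
  qed
  then show ?thesis
    by (simp only: has_field_derivative_iff at_within_open[OF U(3,1)])
qed

text \<open>
  With \<open>p = q / (1 - q)\<close> one has \<open>1 + (z - 1) q = (1 - q) (1 + z p)\<close>. The variable
  \<open>z = 1 + t\<close> thus splits off \<open>L_I(-1)\<close> and leaves \<open>cgf z\<close>, the integral of \<open>log (1 + z p)\<close>,
  which is holomorphic on a half-plane \<open>U\<close> containing both a disc around \<open>0\<close> (for the circle
  integrals) and the whole half-line \<open>z \<ge> 0\<close> (for the supremum in \<open>J_I\<close>).
\<close>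

locale strip =
  fixes \<alpha> \<beta> :: real
  assumes \<alpha>: "0 < \<alpha>" and \<beta>: "\<alpha> < \<beta>"
begin

text \<open>
  Restricting the measure builds \<open>\<xi> > 0\<close> into the underlying space, so that pointwise bounds
  valid only there can be used as they stand.
\<close>

definition half_line :: "real measure" where
  "half_line = restrict_space lborel {0<..}"

lemma space_half_line [simp]: "space half_line = {0<..}"
  by (simp add: half_line_def space_restrict_space)

lemma integral_half_line:
  fixes f :: "real \<Rightarrow> 'a :: {banach, second_countable_topology}"
  shows "(LINT \<xi>|half_line. f \<xi>) = (LBINT \<xi>:{0<..}. f \<xi>)"
  by (simp add: half_line_def integral_restrict_space set_lebesgue_integral_def)

lemma measurable_half_line:
  fixes f :: "real \<Rightarrow> 'a :: topological_space"
  assumes "continuous_on {0<..} f"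
  shows "f \<in> borel_measurable half_line"
proof -
  have "f \<in> borel_measurable (restrict_space borel {0<..})"
    using assms by (rule borel_measurable_continuous_on_restrict)
  then show ?thesis
    unfolding half_line_def by (simp cong: measurable_cong_sets add: sets_restrict_space)
qed

definition q where "q = q_I \<alpha> \<beta>"

definition p where "p \<xi> = q \<xi> / (1 - q \<xi>)"

text \<open>
  An explicit bound for \<open>q\<close> below \<open>1\<close>: the first term serves \<open>\<xi> \<ge> 1\<close>, where the first
  exponential is small, the second \<open>\<xi> \<le> 1\<close>, where the second exponential is bounded below.
\<close>

definition q_bound where "q_bound = max (exp (- 2 * \<alpha>)) (1 - exp (- 2 * \<beta>))"

text \<open>
  Chosen so that \<open>r p(\<xi>) \<le> 1/2\<close> for all \<open>\<xi>\<close>, which keeps \<open>1 + z p(\<xi>)\<close> in the half-plane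
  \<open>Re \<ge> 1/2\<close> for \<open>Re z > -r\<close>.
\<close>

definition r where "r = (1 - q_bound) / 2"

definition U where "U = {z :: complex. - r < Re z}"

lemma q_bound: "0 < q_bound" "q_bound < 1"
  using \<alpha> \<beta> by (auto simp: q_bound_def max_def)

lemma r: "0 < r" "r < 1"
  using q_bound by (auto simp: r_def)

lemma q_pos: "0 < \<xi> \<Longrightarrow> 0 < q \<xi>"
  using \<alpha> \<beta> by (simp add: q_def q_I_def)

lemma q_le:
  assumes "0 < \<xi>"
  shows "q \<xi> \<le> q_bound"
proof (cases "\<xi> \<le> 1")
  case True
  have "exp (- 2 * \<alpha> * \<xi>) \<le> 1" using \<alpha> assms by simp
  moreover have "exp (- 2 * \<beta>) \<le> exp (- 2 * \<beta> * \<xi>)" using \<alpha> \<beta> True by simp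
  ultimately show ?thesis unfolding q_def q_I_def q_bound_def by linarith
next
  case False
  then have "exp (- 2 * \<alpha> * \<xi>) \<le> exp (- 2 * \<alpha>)" using \<alpha> by simp
  moreover have "0 < exp (- 2 * \<beta> * \<xi>)" by simp
  ultimately show ?thesis unfolding q_def q_I_def q_bound_def by linarith
qed

lemma q_lt_1: "0 < \<xi> \<Longrightarrow> q \<xi> < 1"
  using q_le q_bound by fastforce

lemma p_pos: "0 < \<xi> \<Longrightarrow> 0 < p \<xi>"
  using q_pos q_lt_1 by (simp add: p_def)

lemma r_p_le:
  assumes "0 < \<xi>"
  shows "r * p \<xi> \<le> 1/2"
proof -
  have "p \<xi> \<le> q_bound / (1 - q_bound)"
    unfolding p_def using q_le[OF assms] q_bound q_pos[OF assms] by (intro frac_le) auto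
  then have "r * p \<xi> \<le> r * (q_bound / (1 - q_bound))"
    using r by (intro mult_left_mono) auto
  also have "\<dots> = q_bound / 2" using q_bound by (simp add: r_def field_simps)
  also have "\<dots> \<le> 1/2" using q_bound by simp
  finally show ?thesis .
qed

lemma continuous_q: "continuous_on {0<..} q"
  unfolding q_def q_I_def by (intro continuous_intros)

lemma continuous_p: "continuous_on {0<..} p"
  unfolding p_def by (intro continuous_intros continuous_q) (use q_lt_1 in force)

lemma integrable_p: "integrable half_line p"
proof -
  have "set_integrable lborel {0<..} (\<lambda>\<xi>. exp (- (\<xi> * (2 * \<alpha>))))"
    using \<alpha> by (intro integrable_I0i_exp_mscale) simp
  then have "integrable half_line (\<lambda>\<xi>. exp (- (\<xi> * (2 * \<alpha>))))"
    by (simp add: half_line_def integrable_restrict_space set_integrable_def)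
  then have "integrable half_line (\<lambda>\<xi>. exp (- (\<xi> * (2 * \<alpha>))) / (1 - q_bound))"
    by simp
  then show ?thesis
  proof (rule Bochner_Integration.integrable_bound)
    show "p \<in> borel_measurable half_line" by (rule measurable_half_line[OF continuous_p])
    show "AE \<xi> in half_line. norm (p \<xi>) \<le> norm (exp (- (\<xi> * (2 * \<alpha>))) / (1 - q_bound))"
    proof (rule AE_I2)
      fix \<xi> assume "\<xi> \<in> space half_line"
      then have \<xi>: "0 < \<xi>" by simp
      have "q \<xi> \<le> exp (- (\<xi> * (2 * \<alpha>)))" by (simp add: q_def q_I_def mult_ac)
      then have "p \<xi> \<le> exp (- (\<xi> * (2 * \<alpha>))) / (1 - q_bound)"
        unfolding p_def using q_le[OF \<xi>] q_bound q_pos[OF \<xi>] by (intro frac_le) auto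
      then show "norm (p \<xi>) \<le> norm (exp (- (\<xi> * (2 * \<alpha>))) / (1 - q_bound))"
        using p_pos[OF \<xi>] q_bound by simp
    qed
  qed
qed

lemma open_U: "open U" and convex_U: "convex U"
  unfolding U_def by (auto intro: open_halfspace_Re_gt convex_halfspace_Re_gt)

lemma of_real_in_U [simp]: "complex_of_real s \<in> U \<longleftrightarrow> - r < s"
  by (simp add: U_def)

lemma Re_factor_ge:
  fixes z :: complex
  assumes "z \<in> U" "0 < \<xi>"
  shows "1/2 \<le> Re (1 + z * p \<xi>)"
proof -
  have "- r * p \<xi> \<le> Re z * p \<xi>"
    using assms p_pos[OF assms(2)] by (intro mult_right_mono) (auto simp: U_def)
  with r_p_le[OF assms(2)] show ?thesis by simp
qed

lemma one_plus_zp: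
  fixes z :: complex
  assumes "z \<in> U" "0 < \<xi>"
  shows "1/2 \<le> norm (1 + z * p \<xi>)" "1 + z * p \<xi> \<notin> \<real>\<^sub>\<le>\<^sub>0" "1 + z * p \<xi> \<noteq> 0"
proof -
  note Re = Re_factor_ge[OF assms]
  from Re show "1/2 \<le> norm (1 + z * p \<xi>)"
    by (rule order_trans) (rule complex_Re_le_cmod)
  show "1 + z * p \<xi> \<notin> \<real>\<^sub>\<le>\<^sub>0"
  proof
    assume "1 + z * p \<xi> \<in> \<real>\<^sub>\<le>\<^sub>0"
    then have "Re (1 + z * p \<xi>) \<le> 0" by (simp only: complex_nonpos_Reals_iff)
    with Re show False by linarith
  qed
  then show "1 + z * p \<xi> \<noteq> 0" by force
qed

definition cgf :: "complex \<Rightarrow> complex" where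
  "cgf z = 1 / (2 * pi) * (LINT \<xi>|half_line. Ln (1 + z * complex_of_real (p \<xi>)))"

definition cgf' :: "complex \<Rightarrow> complex" where
  "cgf' z = 1 / (2 * pi) * (LINT \<xi>|half_line. complex_of_real (p \<xi>) / (1 + z * complex_of_real (p \<xi>)))"

lemma norm_deriv_le:
  fixes z :: complex
  assumes "z \<in> U" "0 < \<xi>"
  shows "norm (p \<xi> / (1 + z * p \<xi>)) \<le> 2 * p \<xi>"
proof -
  have "norm (p \<xi> / (1 + z * p \<xi>)) = p \<xi> / norm (1 + z * p \<xi>)"
    using p_pos[OF assms(2)] by (simp add: norm_divide)
  also have "\<dots> \<le> p \<xi> / (1/2)"
    using one_plus_zp(1)[OF assms] p_pos[OF assms(2)] by (intro frac_le) auto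
  finally show ?thesis by simp
qed

lemma deriv_Ln_factor:
  fixes z :: complex
  assumes "z \<in> U" "0 < \<xi>"
  shows "((\<lambda>z. Ln (1 + z * p \<xi>)) has_field_derivative (p \<xi> / (1 + z * p \<xi>))) (at z)"
proof -
  have "((\<lambda>z. 1 + z * complex_of_real (p \<xi>)) has_field_derivative p \<xi>) (at z)"
    by (auto intro!: derivative_eq_intros)
  from DERIV_chain2[OF has_field_derivative_Ln[OF one_plus_zp(2)[OF assms]] this] show ?thesis
    by (simp add: divide_inverse mult.commute)
qed

lemma measurable_Ln_factor:
  fixes z :: complex
  assumes "z \<in> U"
  shows "(\<lambda>\<xi>. Ln (1 + z * p \<xi>)) \<in> borel_measurable half_line"
  by (intro measurable_half_line continuous_intros continuous_p) (simp_all add: one_plus_zp[OF assms])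

lemma measurable_deriv_factor:
  fixes z :: complex
  assumes "z \<in> U"
  shows "(\<lambda>\<xi>. complex_of_real (p \<xi>) / (1 + z * p \<xi>)) \<in> borel_measurable half_line"
  by (intro measurable_half_line continuous_intros continuous_p) (simp_all add: one_plus_zp[OF assms])

lemma integrable_Ln_factor:
  fixes z :: complex
  assumes "z \<in> U"
  shows "integrable half_line (\<lambda>\<xi>. Ln (1 + z * p \<xi>))"
proof (rule Bochner_Integration.integrable_bound)
  show "integrable half_line (\<lambda>\<xi>. 2 * p \<xi> * norm z)"
    using integrable_p by simp
  show "AE \<xi> in half_line. norm (Ln (1 + z * p \<xi>)) \<le> norm (2 * p \<xi> * norm z)"
  proof (rule AE_I2)
    fix \<xi> assume "\<xi> \<in> space half_line"
    then have \<xi>: "0 < \<xi>" by simp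
    have 0: "0 \<in> U" using r by (simp add: U_def)
    have "norm (Ln (1 + z * p \<xi>) - Ln (1 + 0 * complex_of_real (p \<xi>))) \<le> 2 * p \<xi> * norm (z - 0)"
      by (rule field_differentiable_bound[OF convex_U has_field_derivative_at_within[OF deriv_Ln_factor[OF _ \<xi>]]
            norm_deriv_le[OF _ \<xi>] assms 0])
    then show "norm (Ln (1 + z * p \<xi>)) \<le> norm (2 * p \<xi> * norm z)"
      using p_pos[OF \<xi>] by simp
  qed
qed (rule measurable_Ln_factor[OF assms])

lemma has_field_derivative_cgf:
  assumes "z \<in> U"
  shows "(cgf has_field_derivative cgf' z) (at z)"
  unfolding cgf_def cgf'_def
  by (intro DERIV_cmult has_field_derivative_integral_dominated[OF open_U convex_U assms, where w = "\<lambda>\<xi>. 2 * p \<xi>"])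
     (use assms integrable_p in \<open>auto intro: deriv_Ln_factor norm_deriv_le integrable_Ln_factor measurable_deriv_factor\<close>)

text \<open>
  Being the derivative of a holomorphic function spares a second differentiation under the
  integral sign.
\<close>

lemma holomorphic_cgf': "cgf' holomorphic_on U"
proof -
  have "cgf holomorphic_on U"
    using has_field_derivative_cgf open_U by (auto simp: holomorphic_on_open)
  then have "deriv cgf holomorphic_on U" by (rule holomorphic_deriv[OF _ open_U])
  then show ?thesis
    by (rule holomorphic_transform) (rule DERIV_imp_deriv[OF has_field_derivative_cgf])
qed

text \<open>
  The factor \<open>1 - q\<close> is positive, so the principal logarithm of the product
  \<open>(1 - q) (1 + z p)\<close> is the sum of the logarithms. Integrability of \<open>log (1 - q)\<close> follows from
  \<open>- log (1 - q) \<le> 1 / (1 - q) - 1 = p\<close>.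
\<close>

lemma L_I_eq:
  fixes z :: complex
  assumes "z \<in> U"
  shows "L_I \<alpha> \<beta> (z - 1) = L_I \<alpha> \<beta> (- 1) + cgf z"
proof -
  have int: "integrable half_line (\<lambda>\<xi>. Ln (1 + (-1) * q \<xi>))"
  proof (rule Bochner_Integration.integrable_bound[OF integrable_p])
    show "(\<lambda>\<xi>. Ln (1 + (-1) * q \<xi>)) \<in> borel_measurable half_line"
      by (intro measurable_half_line continuous_intros continuous_q)
         (use q_lt_1 in \<open>fastforce simp: complex_nonpos_Reals_iff\<close>)
    show "AE \<xi> in half_line. norm (Ln (1 + (-1) * q \<xi>)) \<le> norm (p \<xi>)"
    proof (rule AE_I2)
      fix \<xi> assume "\<xi> \<in> space half_line"
      then have \<xi>: "0 < \<xi>" by simp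
      have q1: "0 < 1 - q \<xi>" using q_lt_1[OF \<xi>] by simp
      have "Ln (1 + (-1) * q \<xi>) = Ln (of_real (1 - q \<xi>))" by simp
      also have "\<dots> = of_real (ln (1 - q \<xi>))" using q1 by (rule Ln_of_real)
      finally have "norm (Ln (1 + (-1) * q \<xi>)) = \<bar>ln (1 - q \<xi>)\<bar>" by simp
      also have "\<dots> = ln (inverse (1 - q \<xi>))" using q1 q_pos[OF \<xi>] by (simp add: ln_inverse)
      also have "\<dots> \<le> inverse (1 - q \<xi>) - 1" using q1 by (intro ln_le_minus_one) simp
      also have "\<dots> = p \<xi>" using q1 by (simp add: p_def field_simps)
      finally show "norm (Ln (1 + (-1) * q \<xi>)) \<le> norm (p \<xi>)" by simp
    qed
  qed
  have "(LINT \<xi>|half_line. Ln (1 + (z - 1) * q \<xi>)) = (LINT \<xi>|half_line. Ln (1 + (-1) * q \<xi>) + Ln (1 + z * p \<xi>))"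
  proof (rule Bochner_Integration.integral_cong)
    fix \<xi> assume "\<xi> \<in> space half_line"
    then have \<xi>: "0 < \<xi>" by simp
    have q1: "0 < 1 - q \<xi>" using q_lt_1[OF \<xi>] by simp
    have "(1 - q \<xi>) * p \<xi> = q \<xi>" using q1 by (simp add: p_def)
    then have qp: "complex_of_real (1 - q \<xi>) * complex_of_real (p \<xi>) = of_real (q \<xi>)"
      by (metis of_real_mult)
    have "of_real (1 - q \<xi>) * (1 + z * p \<xi>)
        = of_real (1 - q \<xi>) + z * (complex_of_real (1 - q \<xi>) * complex_of_real (p \<xi>))"
      by (simp only: distrib_left mult_1_right mult_1_left mult_ac)
    also have "\<dots> = 1 + (z - 1) * q \<xi>"
      unfolding qp by (simp add: algebra_simps)
    finally have "Ln (1 + (z - 1) * q \<xi>) = Ln (of_real (1 - q \<xi>) * (1 + z * p \<xi>))" by simp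
    then have "Ln (1 + (z - 1) * q \<xi>) = of_real (ln (1 - q \<xi>)) + Ln (1 + z * p \<xi>)"
      by (simp only: Ln_times_of_real[OF q1 one_plus_zp(3)[OF assms \<xi>]] Ln_of_real[OF q1])
    also have "of_real (ln (1 - q \<xi>)) = Ln (1 + (-1) * q \<xi>)"
      using Ln_of_real[OF q1] by simp
    finally show "Ln (1 + (z - 1) * q \<xi>) = Ln (1 + (-1) * q \<xi>) + Ln (1 + z * p \<xi>)" .
  qed simp
  also have "\<dots> = (LINT \<xi>|half_line. Ln (1 + (-1) * q \<xi>)) + (LINT \<xi>|half_line. Ln (1 + z * p \<xi>))"
    by (rule Bochner_Integration.integral_add[OF int integrable_Ln_factor[OF assms]])
  finally show ?thesis
    by (simp add: L_I_def cgf_def integral_half_line q_def distrib_left)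
qed

lemma A_I_eq: "- r < s \<Longrightarrow> A_I \<alpha> \<beta> s = Re (cgf s)"
  using L_I_eq[of "of_real s"] by (simp add: A_I_def)

definition A' :: "real \<Rightarrow> real" where
  "A' s = 1 / (2 * pi) * (LINT \<xi>|half_line. p \<xi> / (1 + s * p \<xi>))"

lemma cgf'_of_real: "cgf' (of_real s) = of_real (A' s)"
proof -
  have "(LINT \<xi>|half_line. complex_of_real (p \<xi>) / (1 + of_real s * p \<xi>))
        = (LINT \<xi>|half_line. complex_of_real (p \<xi> / (1 + s * p \<xi>)))" by simp
  also have "\<dots> = of_real (LINT \<xi>|half_line. p \<xi> / (1 + s * p \<xi>))"
    by (rule integral_complex_of_real)
  finally show ?thesis by (simp add: cgf'_def A'_def)
qed

lemma has_real_derivative_A_I: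
  assumes "- r < s"
  shows "(A_I \<alpha> \<beta> has_real_derivative A' s) (at s)"
proof -
  have "((\<lambda>x. cgf (of_real x)) has_vector_derivative cgf' (of_real s)) (at s)"
    using assms by (intro has_vector_derivative_real_field has_field_derivative_cgf) simp
  from has_field_derivative_Re[OF this] have "((\<lambda>x. Re (cgf (of_real x))) has_field_derivative A' s) (at s)"
    by (simp add: cgf'_of_real)
  then show ?thesis
    by (rule has_field_derivative_transform_within_open[of _ _ _ "{-r<..}"]) (use assms A_I_eq in auto)
qed

lemma deriv_A_I: "- r < s \<Longrightarrow> deriv (A_I \<alpha> \<beta>) s = A' s"
  by (rule DERIV_imp_deriv[OF has_real_derivative_A_I])

lemma has_real_derivative_A':
  assumes "- r < s"
  shows "(A' has_real_derivative Re (deriv cgf' (of_real s))) (at s)"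
proof -
  have "(cgf' has_field_derivative deriv cgf' (of_real s)) (at (of_real s))"
    using assms by (intro holomorphic_derivI[OF holomorphic_cgf' open_U]) simp
  then have "((\<lambda>x. cgf' (of_real x)) has_vector_derivative deriv cgf' (of_real s)) (at s)"
    by (rule has_vector_derivative_real_field)
  from has_field_derivative_Re[OF this] show ?thesis by (simp add: cgf'_of_real)
qed

lemma deriv2_A_I:
  assumes "- r < s"
  shows "(deriv ^^ 2) (A_I \<alpha> \<beta>) s = Re (deriv cgf' (of_real s))"
proof -
  have "(deriv (A_I \<alpha> \<beta>) has_real_derivative Re (deriv cgf' (of_real s))) (at s)"
    by (rule has_field_derivative_transform_within_open[OF has_real_derivative_A', of _ "{-r<..}"])
       (use assms deriv_A_I in auto)
  then show ?thesis by (simp add: numeral_2_eq_2 DERIV_imp_deriv)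
qed

lemma A'_0: "A' 0 = kappa_I \<alpha> \<beta>"
  by (simp add: A'_def kappa_I_def integral_half_line p_def q_def)

lemma integrable_deriv_factor:
  assumes "0 \<le> s"
  shows "integrable half_line (\<lambda>\<xi>. p \<xi> / (1 + s * p \<xi>))"
proof (rule Bochner_Integration.integrable_bound[OF integrable_p])
  have pos: "1 + s * p \<xi> \<ge> 1" if "0 < \<xi>" for \<xi>
    using p_pos[OF that] assms by simp
  show "(\<lambda>\<xi>. p \<xi> / (1 + s * p \<xi>)) \<in> borel_measurable half_line"
    by (intro measurable_half_line continuous_intros continuous_p) (use pos in force)
  show "AE \<xi> in half_line. norm (p \<xi> / (1 + s * p \<xi>)) \<le> norm (p \<xi>)"
  proof (rule AE_I2)
    fix \<xi> assume "\<xi> \<in> space half_line"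
    then have \<xi>: "0 < \<xi>" by simp
    have "p \<xi> / (1 + s * p \<xi>) \<le> p \<xi> / 1" using pos[OF \<xi>] p_pos[OF \<xi>] by (intro frac_le) auto
    then show "norm (p \<xi> / (1 + s * p \<xi>)) \<le> norm (p \<xi>)"
      using pos[OF \<xi>] p_pos[OF \<xi>] by simp
  qed
qed

lemma integral_half_line_strict_mono:
  fixes f g :: "real \<Rightarrow> real"
  assumes int: "integrable half_line f" "integrable half_line g"
    and less: "\<And>\<xi>. 0 < \<xi> \<Longrightarrow> f \<xi> < g \<xi>"
  shows "(LINT \<xi>|half_line. f \<xi>) < (LINT \<xi>|half_line. g \<xi>)"
proof -
  have "emeasure lborel {0<..1::real} \<le> emeasure lborel {0::real<..}"
    by (intro emeasure_mono) auto
  then have "emeasure lborel {0::real<..} \<noteq> 0" by auto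
  then have nonnull: "emeasure half_line (space half_line) \<noteq> 0"
    by (simp add: half_line_def emeasure_restrict_space space_restrict_space)
  have "(LINT \<xi>|half_line. g \<xi> - f \<xi>) \<noteq> 0"
  proof
    assume "(LINT \<xi>|half_line. g \<xi> - f \<xi>) = 0"
    then have "AE \<xi> in half_line. g \<xi> - f \<xi> = 0"
      using less int by (subst (asm) integral_nonneg_eq_0_iff_AE) (auto intro!: AE_I2 less_imp_le)
    moreover have "AE \<xi> in half_line. g \<xi> - f \<xi> \<noteq> 0"
      using less by (intro AE_I2) fastforce
    ultimately have "AE \<xi> in half_line. False" by eventually_elim simp
    with nonnull show False by (simp only: eventually_False ae_filter_eq_bot_iff)
  qed
  moreover have "0 \<le> (LINT \<xi>|half_line. g \<xi> - f \<xi>)"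
    using less by (intro integral_nonneg_AE AE_I2) (auto intro: less_imp_le)
  ultimately show ?thesis using int by simp
qed

lemma kappa_pos: "0 < kappa_I \<alpha> \<beta>"
proof -
  have "(LINT \<xi>|half_line. 0) < (LINT \<xi>|half_line. p \<xi>)"
    by (rule integral_half_line_strict_mono[OF _ integrable_p p_pos]) auto
  then show ?thesis by (simp add: A'_0[symmetric] A'_def)
qed

text \<open>
  In the variable \<open>z = 1 + t\<close> the cut starts at \<open>1 - 1 / \<rho>\<close>, which lies to the left of \<open>-r\<close>
  since \<open>\<rho> \<le> q_bound\<close>.
\<close>

lemma ball_subset_Omega: "ball (-1) r \<subseteq> Omega_I \<alpha> \<beta>"
proof
  fix t :: complex assume t: "t \<in> ball (-1) r"
  have "bdd_above (q_I \<alpha> \<beta> ` {0<..})"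
    using q_le by (intro bdd_aboveI2[where M = q_bound]) (auto simp: q_def)
  then have "q 1 \<le> rho_I \<alpha> \<beta>"
    unfolding rho_I_def q_def by (intro cSUP_upper) auto
  then have rho_pos: "0 < rho_I \<alpha> \<beta>" using q_pos[of 1] by simp
  have "rho_I \<alpha> \<beta> \<le> q_bound"
    unfolding rho_I_def using q_le by (intro cSUP_least) (auto simp: q_def)
  then have "inverse q_bound \<le> inverse (rho_I \<alpha> \<beta>)"
    using rho_pos by (intro le_imp_inverse_le)
  moreover have "1 + r < inverse q_bound"
  proof -
    have "q_bound * r < 1 * r" using q_bound r by (intro mult_strict_right_mono) auto
    moreover have "q_bound * (1 + r) = q_bound + q_bound * r" by (simp add: distrib_left)
    moreover have "q_bound + r < 1" using q_bound by (simp add: r_def field_simps)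
    ultimately have "q_bound * (1 + r) < 1" by simp
    then show ?thesis using q_bound by (simp add: field_simps)
  qed
  moreover have "- 1 - r < Re t"
    using t abs_Re_le_cmod[of "t + 1"] by (simp add: dist_norm norm_minus_commute add.commute)
  ultimately have "Re t > - inverse (rho_I \<alpha> \<beta>)" by simp
  then show "t \<in> Omega_I \<alpha> \<beta>" by (auto simp: Omega_I_def)
qed

lemma cball_subset_U: "cball 0 (r / 2) \<subseteq> U"
proof
  fix z :: complex assume "z \<in> cball 0 (r / 2)"
  then have "norm z \<le> r / 2" by simp
  then show "z \<in> U" using abs_Re_le_cmod[of z] r unfolding U_def mem_Collect_eq by linarith
qed

lemma cgf_Taylor_bound:
  obtains B where "0 \<le> B"
    "\<And>z s. z \<in> cball 0 (r / 2) \<Longrightarrow> s \<in> cball 0 (r / 2) \<Longrightarrow> norm (cgf z - cgf s - cgf' s * (z - s)) \<le> B * (norm (z - s))\<^sup>2"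
proof -
  have "compact (deriv cgf' ` cball 0 (r / 2))"
    by (intro compact_continuous_image holomorphic_on_imp_continuous_on holomorphic_on_subset[OF _ cball_subset_U]
        holomorphic_deriv holomorphic_cgf' open_U) simp
  then have "bounded (deriv cgf' ` cball 0 (r / 2))" by (rule compact_imp_bounded)
  then obtain B where B: "0 < B" "\<And>z. z \<in> cball 0 (r / 2) \<Longrightarrow> norm (deriv cgf' z) \<le> B"
    unfolding bounded_pos by auto
  define f where "f i = (if i = 0 then cgf else if i = 1 then cgf' else deriv cgf')" for i :: nat
  have "norm (cgf z - cgf s - cgf' s * (z - s)) \<le> B * (norm (z - s))\<^sup>2" if "z \<in> cball 0 (r / 2)" "s \<in> cball 0 (r / 2)" for z s
  proof -
    have "cmod (f 0 z - (\<Sum>i\<le>1. f i s * (z - s) ^ i / fact i)) \<le> B * cmod (z - s) ^ Suc 1 / fact 1"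
    proof (rule complex_Taylor[OF convex_cball[of 0 "r/2"]])
      fix i and x :: complex assume x: "x \<in> cball 0 (r / 2)" and "i \<le> (1::nat)"
      then have i: "i = 0 \<or> i = 1" by auto
      have "x \<in> U" using x cball_subset_U by blast
      with i show "(f i has_field_derivative f (Suc i) x) (at x within cball 0 (r / 2))"
        by (auto simp: f_def intro!: has_field_derivative_at_within[OF has_field_derivative_cgf]
             has_field_derivative_at_within[OF holomorphic_derivI[OF holomorphic_cgf' open_U]])
    qed (use that B in \<open>auto simp: f_def\<close>)
    then show ?thesis by (simp add: f_def power2_eq_square algebra_simps)
  qed
  then show ?thesis using that[of B] B by auto
qed

section \<open>The saddle point\<close>

text \<open>
  The integrand \<open>s p / (1 + s p)\<close> is strictly increasing in \<open>s\<close> for every \<open>\<xi>\<close>. This makes the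
  saddle point unique and the function maximised in \<open>J_I\<close> unimodal.
\<close>

lemma s_A'_strict_mono:
  assumes "0 \<le> s" "s < t"
  shows "s * A' s < t * A' t"
proof -
  have "(LINT \<xi>|half_line. s * (p \<xi> / (1 + s * p \<xi>))) < (LINT \<xi>|half_line. t * (p \<xi> / (1 + t * p \<xi>)))"
  proof (rule integral_half_line_strict_mono)
    fix \<xi> :: real assume "0 < \<xi>"
    then have "0 < p \<xi>" by (rule p_pos)
    then have "s * p \<xi> < t * p \<xi>" and "0 \<le> s * p \<xi>" using assms by auto
    then show "s * (p \<xi> / (1 + s * p \<xi>)) < t * (p \<xi> / (1 + t * p \<xi>))"
      by (simp add: divide_simps) (simp add: algebra_simps)
  next
    show "integrable half_line (\<lambda>\<xi>. s * (p \<xi> / (1 + s * p \<xi>)))"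
      using assms by (intro integrable_mult_right integrable_deriv_factor)
    show "integrable half_line (\<lambda>\<xi>. t * (p \<xi> / (1 + t * p \<xi>)))"
      using assms by (intro integrable_mult_right integrable_deriv_factor) simp
  qed
  moreover have "u * A' u = 1 / (2 * pi) * (LINT \<xi>|half_line. u * (p \<xi> / (1 + u * p \<xi>)))" for u
    by (subst integral_mult_right_zero) (simp add: A'_def)
  ultimately show ?thesis by (simp add: divide_strict_right_mono)
qed

lemma saddle_eqI:
  assumes "0 < s" "s * A' s = real n / L"
  shows "saddle \<alpha> \<beta> L n = s"
  unfolding saddle_def
proof (rule the_equality)
  show "0 < s \<and> s * deriv (A_I \<alpha> \<beta>) s = real n / L"
    using assms r by (simp add: deriv_A_I)
  fix t assume t: "0 < t \<and> t * deriv (A_I \<alpha> \<beta>) t = real n / L"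
  then have eq: "t * A' t = s * A' s" using assms r deriv_A_I[of t] by simp
  have "\<not> s < t" using s_A'_strict_mono[of s t] assms(1) eq by fastforce
  moreover have "\<not> t < s" using s_A'_strict_mono[of t s] t eq by fastforce
  ultimately show "t = s" by simp
qed

lemma continuous_s_A': "continuous_on {0..} (\<lambda>s. s * A' s)"
proof (intro continuous_on_mult continuous_on_id continuous_at_imp_continuous_on ballI)
  fix s :: real assume "s \<in> {0..}"
  then show "isCont A' s" using r by (intro DERIV_isCont[OF has_real_derivative_A']) auto
qed

text \<open>
  A saddle point below \<open>\<eta>\<close> exists by the intermediate value theorem once \<open>n / L\<close> is below the
  value of \<open>s A'(s)\<close> at \<open>\<eta>\<close>. As \<open>\<eta>\<close> is arbitrary, this also shows that saddle points tend to \<open>0\<close>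
  with \<open>n / L\<close>.
\<close>

lemma saddle_small:
  assumes \<eta>: "0 < \<eta>" and x: "0 < real n / L" "real n / L < \<eta> * A' \<eta>"
  shows "0 < saddle \<alpha> \<beta> L n" "saddle \<alpha> \<beta> L n < \<eta>"
    "saddle \<alpha> \<beta> L n * A' (saddle \<alpha> \<beta> L n) = real n / L"
proof -
  have "\<exists>s\<ge>0. s \<le> \<eta> \<and> s * A' s = real n / L"
    by (rule IVT') (use assms continuous_on_subset[OF continuous_s_A'] in auto)
  then obtain s where s: "0 \<le> s" "s \<le> \<eta>" "s * A' s = real n / L" by blast
  then have "s \<noteq> 0" "s \<noteq> \<eta>" using x by auto
  with s have s': "0 < s" "s < \<eta>" by auto
  with s(3) saddle_eqI[OF s'(1) s(3)] show "0 < saddle \<alpha> \<beta> L n" "saddle \<alpha> \<beta> L n < \<eta>"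
    "saddle \<alpha> \<beta> L n * A' (saddle \<alpha> \<beta> L n) = real n / L" by auto
qed

text \<open>
  The derivative \<open>(x - u A'(u)) / u\<close> of \<open>x log u - A(u)\<close> changes sign from plus to minus at \<open>s\<close>,
  because \<open>u A'(u)\<close> is increasing.
\<close>

lemma J_I_eq:
  assumes "0 < s" "s * A' s = x"
  shows "J_I \<alpha> \<beta> x = - Re (L_I \<alpha> \<beta> (- 1)) + (x * ln s - A_I \<alpha> \<beta> s)"
proof -
  let ?h = "\<lambda>u. x * ln u - A_I \<alpha> \<beta> u"
  have der: "(?h has_real_derivative (x - u * A' u) / u) (at u)" if "0 < u" for u
    using that r by (auto intro!: derivative_eq_intros has_real_derivative_A_I simp: diff_divide_distrib)
  have "?h u \<le> ?h s" if u: "0 < u" for u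
  proof (cases "u \<le> s")
    case True
    show ?thesis
    proof (rule DERIV_nonneg_imp_nondecreasing[OF True])
      fix v assume v: "u \<le> v" "v \<le> s"
      have "v * A' v \<le> x" using s_A'_strict_mono[of v s] v u assms by (cases "v = s") auto
      then show "\<exists>y. (?h has_real_derivative y) (at v) \<and> 0 \<le> y"
        using u v by (intro exI[of _ "(x - v * A' v) / v"] conjI der) auto
    qed
  next
    case False
    then have "s \<le> u" by simp
    then show ?thesis
    proof (rule DERIV_nonpos_imp_nonincreasing)
      fix v assume v: "s \<le> v" "v \<le> u"
      have "x \<le> v * A' v" using s_A'_strict_mono[of s v] v u assms by (cases "v = s") auto
      then show "\<exists>y. (?h has_real_derivative y) (at v) \<and> y \<le> 0"
        using assms v by (intro exI[of _ "(x - v * A' v) / v"] conjI der) (auto simp: divide_le_0_iff)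
    qed
  qed
  then have "(SUP u\<in>{0<..}. ?h u) = ?h s"
    using assms by (intro cSup_eq_maximum) auto
  then show ?thesis by (simp add: J_I_def)
qed

text \<open>
  From \<open>n = L s A'(s)\<close> one gets \<open>L V(s) / n = 1 + s A''(s) / A'(s)\<close>, and with \<open>s \<rightarrow> 0\<close> the
  derivative \<open>A''(s)\<close> converges while \<open>A'(s) \<rightarrow> \<kappa> > 0\<close>.
\<close>

lemma saddle_sequence:
  fixes X :: "nat \<Rightarrow> real" and m :: "nat \<Rightarrow> nat"
  assumes X: "\<forall>\<^sub>F k in sequentially. 0 < X k" and m: "\<forall>\<^sub>F k in sequentially. 0 < m k"
    and x: "(\<lambda>k. m k / X k) \<longlonglongrightarrow> 0"
  defines "s \<equiv> \<lambda>k. saddle \<alpha> \<beta> (X k) (m k)"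
  shows "s \<longlonglongrightarrow> 0"
    and "\<forall>\<^sub>F k in sequentially. 0 < s k \<and> s k < r / 2 \<and> s k * A' (s k) = m k / X k"
    and "(\<lambda>k. A' (s k)) \<longlonglongrightarrow> kappa_I \<alpha> \<beta>"
    and "(\<lambda>k. X k * V_I \<alpha> \<beta> (s k) / m k) \<longlonglongrightarrow> 1"
proof -
  have ev: "\<forall>\<^sub>F k in sequentially. 0 < s k \<and> s k < \<eta> \<and> s k * A' (s k) = m k / X k" if \<eta>: "0 < \<eta>" for \<eta>
  proof -
    have "0 < \<eta> * A' \<eta>" using s_A'_strict_mono[of 0 \<eta>] \<eta> by simp
    with x have "\<forall>\<^sub>F k in sequentially. m k / X k < \<eta> * A' \<eta>" by (rule order_tendstoD)
    with X m show ?thesis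
    proof eventually_elim
      case (elim k)
      then have "0 < real (m k) / X k" by simp
      from saddle_small[OF \<eta> this elim(3)] show ?case by (simp add: s_def)
    qed
  qed
  show s0: "s \<longlonglongrightarrow> 0"
  proof (rule tendstoI)
    fix e :: real assume "e > 0"
    from ev[OF this] show "\<forall>\<^sub>F k in sequentially. dist (s k) 0 < e"
      by eventually_elim simp
  qed
  show sad: "\<forall>\<^sub>F k in sequentially. 0 < s k \<and> s k < r / 2 \<and> s k * A' (s k) = m k / X k"
    using r by (intro ev) simp
  have "isCont A' 0" using r by (intro DERIV_isCont[OF has_real_derivative_A']) simp
  from isCont_tendsto_compose[OF this s0] show A': "(\<lambda>k. A' (s k)) \<longlonglongrightarrow> kappa_I \<alpha> \<beta>"
    by (simp add: A'_0)
  have "continuous_on U (deriv cgf')"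
    by (intro holomorphic_on_imp_continuous_on holomorphic_deriv holomorphic_cgf' open_U)
  then have "isCont (deriv cgf') (of_real 0)"
    using r by (intro continuous_on_interior[of U]) (simp_all only: interior_open[OF open_U] of_real_in_U neg_less_0_iff_less)
  from isCont_tendsto_compose[OF this tendsto_of_real[OF s0]]
  have A'': "(\<lambda>k. Re (deriv cgf' (of_real (s k)))) \<longlonglongrightarrow> Re (deriv cgf' 0)"
    by (intro tendsto_Re) simp
  have "(\<lambda>k. 1 + s k * Re (deriv cgf' (of_real (s k))) / A' (s k))
      \<longlonglongrightarrow> 1 + 0 * Re (deriv cgf' 0) / kappa_I \<alpha> \<beta>"
    using kappa_pos by (intro tendsto_intros s0 A' A'') simp
  moreover have "\<forall>\<^sub>F k in sequentially.
      1 + s k * Re (deriv cgf' (of_real (s k))) / A' (s k) = X k * V_I \<alpha> \<beta> (s k) / m k"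
    using sad X m
  proof eventually_elim
    case (elim k)
    have pos: "- r < s k" using elim r by linarith
    have V: "V_I \<alpha> \<beta> (s k) = s k * A' (s k) + (s k)\<^sup>2 * Re (deriv cgf' (of_real (s k)))"
      unfolding V_I_def deriv_A_I[OF pos] deriv2_A_I[OF pos] ..
    have n: "real (m k) = X k * (s k * A' (s k))" using elim(1,2) by simp
    then have "A' (s k) \<noteq> 0" using elim(3) by (intro notI) simp
    moreover have "s k \<noteq> 0" "X k \<noteq> 0" using elim(1,2) by auto
    ultimately show ?case unfolding V n by (simp add: field_simps power2_eq_square)
  qed
  ultimately show "(\<lambda>k. X k * V_I \<alpha> \<beta> (s k) / m k) \<longlonglongrightarrow> 1"
    by (simp add: tendsto_cong)
qed

section \<open>Asymptotics of the point probabilities\<close>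

text \<open>
  Here \<open>\<Phi>\<close> is the exponent on the circle through the saddle point minus
  \<open>L L_I(s - 1) + D(s - 1)\<close>, the approximate value of that exponent at \<open>\<theta> = 0\<close>. Its distance to the Poisson phase has three
  sources: the error term in the asymptotics of the generating function, the variation of \<open>D\<close> along
  the circle, of order \<open>s\<close>, and the Taylor remainder of \<open>L A\<close>, of order \<open>L s\<^sup>2 \<theta>\<^sup>2\<close>, that is
  \<open>n s \<theta>\<^sup>2\<close> up to a constant. The quotient in question is then the normalised integral of
  \<open>exp \<Phi>\<close> times \<open>sqrt (L V / n)\<close>.
\<close>

lemma point_probability_limit:
  fixes M :: "'w measure" and Z :: "'w \<Rightarrow> complex set"
    and X :: "nat \<Rightarrow> real" and m :: "nat \<Rightarrow> nat"
  assumes M: "prob_space M"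
    and N: "\<And>L. N_I Z \<alpha> \<beta> L \<in> measurable M (count_space UNIV)"
    and D: "is_D_I M Z \<alpha> \<beta> D"
    and X: "filterlim X at_top sequentially"
    and m: "filterlim (\<lambda>k. real (m k)) at_top sequentially"
    and x: "(\<lambda>k. m k / X k) \<longlonglongrightarrow> 0"
  defines "s \<equiv> \<lambda>k. saddle \<alpha> \<beta> (X k) (m k)"
  shows "(\<lambda>k. measure M {\<omega> \<in> space M. N_I Z \<alpha> \<beta> (X k) \<omega> = m k} /
            (exp (- X k * J_I \<alpha> \<beta> (m k / X k) + Re (D (of_real (s k - 1))))
              / sqrt (2 * pi * X k * V_I \<alpha> \<beta> (s k)))) \<longlonglongrightarrow> 1"
proof -
  interpret M: prob_space M by (rule M)
  have X0: "\<forall>\<^sub>F k in sequentially. 0 < X k" using X by (simp add: filterlim_at_top_dense)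
  have m0: "\<forall>\<^sub>F k in sequentially. 0 < m k"
    using m by (auto simp: filterlim_at_top_dense dest: spec[of _ 0])
  have s_eq: "saddle \<alpha> \<beta> (X k) (m k) = s k" for k by (simp add: s_def)
  note sad = saddle_sequence[OF X0 m0 x, unfolded s_eq]
  obtain G where G: "is_log_pgf M Z \<alpha> \<beta> G"
      "\<And>C. compact C \<Longrightarrow> C \<subseteq> Omega_I \<alpha> \<beta> \<Longrightarrow>
         uniform_limit C (\<lambda>L t. G L t - of_real L * L_I \<alpha> \<beta> t) D at_top"
    and D_hol: "D holomorphic_on Omega_I \<alpha> \<beta>"
    using D unfolding is_D_I_def by blast
  define C where "C = cball (-1 :: complex) (r / 2)"
  have C_ball: "C \<subseteq> ball (-1) r" using r by (auto simp: C_def)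
  then have C_Omega: "C \<subseteq> Omega_I \<alpha> \<beta>" using ball_subset_Omega by blast
  have circle: "of_real u * iexp \<theta> - 1 \<in> C" "of_real u * iexp \<theta> \<in> cball 0 (r / 2)" "of_real u * iexp \<theta> \<in> U"
    if "0 \<le> u" "u < r / 2" for u \<theta>
  proof -
    have "norm (of_real u * iexp \<theta>) = u" using that by (simp add: norm_mult)
    then show "of_real u * iexp \<theta> \<in> cball 0 (r / 2)" "of_real u * iexp \<theta> - 1 \<in> C"
      using that by (auto simp: C_def dist_norm norm_minus_commute)
    then show "of_real u * iexp \<theta> \<in> U" using cball_subset_U by blast
  qed
  have "uniform_limit C (\<lambda>L t. G L t - of_real L * L_I \<alpha> \<beta> t) D at_top"
    using G(2) C_Omega by (simp add: C_def)
  moreover have "C \<noteq> {}" using r by (auto simp: C_def)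
  ultimately obtain \<eta>1 where \<eta>1: "(\<eta>1 \<longlongrightarrow> 0) at_top"
      "\<forall>\<^sub>F L in at_top. \<forall>t\<in>C. dist (G L t - of_real L * L_I \<alpha> \<beta> t) (D t) \<le> \<eta>1 L"
    by (rule uniform_limit_rate)
  have D_ball: "D holomorphic_on ball (-1) r"
    using D_hol ball_subset_Omega by (rule holomorphic_on_subset)
  have "compact (deriv D ` C)"
    unfolding C_def
    by (intro compact_continuous_image holomorphic_on_imp_continuous_on
        holomorphic_on_subset[OF _ C_ball[unfolded C_def]] holomorphic_deriv D_ball open_ball) simp
  then have "bounded (deriv D ` C)" by (rule compact_imp_bounded)
  then obtain B where B: "0 < B" "\<And>t. t \<in> C \<Longrightarrow> norm (deriv D t) \<le> B"
    unfolding bounded_pos by auto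
  have D_lip: "norm (D t - D u) \<le> B * norm (t - u)" if "t \<in> C" "u \<in> C" for t u
  proof (rule field_differentiable_bound[where S = C and f' = "deriv D"])
    show "(D has_field_derivative deriv D z) (at z within C)" if "z \<in> C" for z
      using that C_ball by (intro has_field_derivative_at_within[OF holomorphic_derivI[OF D_ball]]) auto
  qed (use that B in \<open>auto simp: C_def\<close>)
  obtain T where T: "0 \<le> T" "\<And>z s. z \<in> cball 0 (r / 2) \<Longrightarrow> s \<in> cball 0 (r / 2) \<Longrightarrow>
      norm (cgf z - cgf s - cgf' s * (z - s)) \<le> T * (norm (z - s))\<^sup>2"
    using cgf_Taylor_bound by blast

  define \<Phi> where "\<Phi> k \<theta> = G (X k) (of_real (s k) * iexp \<theta> - 1) - \<i> * (m k * \<theta>)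
      - of_real (X k) * L_I \<alpha> \<beta> (of_real (s k) - 1) - D (of_real (s k) - 1)" for k and \<theta> :: real
  define \<delta> where "\<delta> k = T * s k / A' (s k)" for k
  define \<eta> where "\<eta> k = \<eta>1 (X k) + B * (2 * s k)" for k
  have iexp_minus_1: "norm (iexp \<theta> - 1) \<le> \<bar>\<theta>\<bar>" for \<theta>
    using iexp_approx1[of \<theta> 0] by simp
  have "(\<lambda>k. sqrt (m k) * (LBINT \<theta>:{-pi..pi}. exp (\<Phi> k \<theta>))) \<longlonglongrightarrow> complex_of_real (sqrt (2 * pi))"
  proof (rule laplace_poisson_phase[OF m])
    have "(\<lambda>k. T * s k / A' (s k)) \<longlonglongrightarrow> T * 0 / kappa_I \<alpha> \<beta>"
      using kappa_pos by (intro tendsto_intros sad(1,3)) simp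
    then show "\<delta> \<longlonglongrightarrow> 0" by (simp add: \<delta>_def[abs_def])
    have "(\<lambda>k. \<eta>1 (X k) + B * (2 * s k)) \<longlonglongrightarrow> 0 + B * (2 * 0)"
      by (intro tendsto_intros sad(1) filterlim_compose[OF \<eta>1(1) X])
    then show "\<eta> \<longlonglongrightarrow> 0" by (simp add: \<eta>_def[abs_def])
    show "\<forall>\<^sub>F k in sequentially. continuous_on {-pi..pi} (\<Phi> k)"
      using sad(2) X0
    proof eventually_elim
      case (elim k)
      have "G (X k) holomorphic_on Omega_I \<alpha> \<beta>"
        using G(1) elim unfolding is_log_pgf_def by blast
      then have "continuous_on C (G (X k))"
        using C_Omega holomorphic_on_imp_continuous_on continuous_on_subset by blast
      moreover have "continuous_on {-pi..pi} (\<lambda>\<theta>. of_real (s k) * iexp \<theta> - 1)"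
        by (intro continuous_intros)
      moreover have "(\<lambda>\<theta>. of_real (s k) * iexp \<theta> - 1) ` {-pi..pi} \<subseteq> C"
        using elim by (intro image_subsetI circle(1)) simp_all
      ultimately have "continuous_on {-pi..pi} (\<lambda>\<theta>. G (X k) (of_real (s k) * iexp \<theta> - 1))"
        by (rule continuous_on_compose2)
      moreover have "continuous_on {-pi..pi} (\<lambda>\<theta>. \<i> * complex_of_real (m k * \<theta>))"
        by (intro continuous_intros)
      ultimately show ?case unfolding \<Phi>_def
        by (intro continuous_on_diff continuous_on_const)
    qed
    show "\<forall>\<^sub>F k in sequentially. \<forall>\<theta>\<in>{-pi..pi}.
        cmod (\<Phi> k \<theta> - of_real (real (m k)) * (iexp \<theta> - 1 - \<i> * \<theta>)) \<le> real (m k) * \<delta> k * \<theta>\<^sup>2 + \<eta> k"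
      using sad(2) X0 m0 eventually_compose_filterlim[OF \<eta>1(2) X]
    proof eventually_elim
      case (elim k)
      show ?case
      proof
        fix \<theta> :: real
        let ?s = "complex_of_real (s k)"
        define z where "z = ?s * iexp \<theta>"
        have s: "0 \<le> s k" "s k < r / 2" using elim by auto
        have z_in: "z - 1 \<in> C" "z \<in> cball 0 (r / 2)" "z \<in> U"
          unfolding z_def by (rule circle[OF s])+
        have s_in: "?s - 1 \<in> C" "?s \<in> cball 0 (r / 2)" "?s \<in> U"
          using circle[OF s, of 0] by auto
        have zs: "norm (z - ?s) = s k * norm (iexp \<theta> - 1)"
        proof -
          have "z - ?s = ?s * (iexp \<theta> - 1)" by (simp add: z_def algebra_simps)
          then show ?thesis using s by (simp only: norm_mult norm_of_real abs_of_nonneg)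
        qed
        have n: "real (m k) = X k * (s k * A' (s k))" using elim(1,2) by simp
        then have A'_pos: "A' (s k) \<noteq> 0" using elim(3) by (intro notI) simp
        have e1: "norm (G (X k) (z - 1) - of_real (X k) * L_I \<alpha> \<beta> (z - 1) - D (z - 1)) \<le> \<eta>1 (X k)"
          using elim(4) z_in(1) by (simp add: dist_norm)
        have e2: "norm (D (z - 1) - D (?s - 1)) \<le> B * (2 * s k)"
        proof -
          have "norm (iexp \<theta> - 1) \<le> 2"
            using norm_triangle_ineq4[of "iexp \<theta>" 1] by simp
          then have "norm (z - ?s) \<le> s k * 2" unfolding zs using s by (intro mult_left_mono)
          moreover have "norm (D (z - 1) - D (?s - 1)) \<le> B * norm (z - ?s)"
            using D_lip[OF z_in(1) s_in(1)] by simp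
          ultimately show ?thesis using B(1) mult_left_mono[of "norm (z - ?s)" "2 * s k" B] by linarith
        qed
        have e3: "norm (of_real (X k) * (cgf z - cgf ?s - cgf' ?s * (z - ?s))) \<le> real (m k) * \<delta> k * \<theta>\<^sup>2"
        proof -
          have "(norm (z - ?s))\<^sup>2 \<le> (s k * \<bar>\<theta>\<bar>)\<^sup>2"
            unfolding zs using s iexp_minus_1 by (intro power_mono mult_left_mono) auto
          then have "T * (norm (z - ?s))\<^sup>2 \<le> T * (s k * \<bar>\<theta>\<bar>)\<^sup>2"
            using T(1) by (rule mult_left_mono)
          with T(2)[OF z_in(2) s_in(2)]
          have "norm (cgf z - cgf ?s - cgf' ?s * (z - ?s)) \<le> T * (s k * \<bar>\<theta>\<bar>)\<^sup>2" by linarith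
          then have "X k * norm (cgf z - cgf ?s - cgf' ?s * (z - ?s)) \<le> X k * (T * (s k * \<bar>\<theta>\<bar>)\<^sup>2)"
            using elim by (intro mult_left_mono) auto
          also have "\<dots> = real (m k) * \<delta> k * \<theta>\<^sup>2"
            unfolding n \<delta>_def using A'_pos by (simp add: power2_eq_square)
          finally show ?thesis using elim by (simp add: norm_mult)
        qed
        \<comment> \<open>The saddle point equation turns the linear Taylor term into a Poisson exponent.\<close>
        have lin: "of_real (X k) * (cgf' ?s * (z - ?s)) = of_real (real (m k)) * (iexp \<theta> - 1)"
          unfolding n cgf'_of_real z_def by (simp add: algebra_simps)
        have "\<Phi> k \<theta> - of_real (real (m k)) * (iexp \<theta> - 1 - \<i> * \<theta>)
            = \<Phi> k \<theta> + of_real (real (m k)) * (\<i> * \<theta>) - of_real (X k) * (cgf' ?s * (z - ?s))"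
          unfolding lin by (simp add: algebra_simps)
        also have "\<dots> = (G (X k) (z - 1) - of_real (X k) * L_I \<alpha> \<beta> (z - 1) - D (z - 1))
            + (D (z - 1) - D (?s - 1)) + of_real (X k) * (cgf z - cgf ?s - cgf' ?s * (z - ?s))"
          unfolding \<Phi>_def z_def[symmetric] L_I_eq[OF z_in(3)] L_I_eq[OF s_in(3)]
          by (simp add: algebra_simps)
        finally have eq: "\<Phi> k \<theta> - of_real (real (m k)) * (iexp \<theta> - 1 - \<i> * \<theta>) = \<dots>" .
        show "cmod (\<Phi> k \<theta> - of_real (real (m k)) * (iexp \<theta> - 1 - \<i> * \<theta>)) \<le> real (m k) * \<delta> k * \<theta>\<^sup>2 + \<eta> k"
          unfolding eq \<eta>_def
          by (rule order_trans[OF norm_triangle_ineq])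
             (use norm_triangle_le[OF add_mono[OF e1 e2]] e3 in linarith)
      qed
    qed
  qed
  then have "(\<lambda>k. norm (sqrt (m k) * (LBINT \<theta>:{-pi..pi}. exp (\<Phi> k \<theta>))))
      \<longlonglongrightarrow> norm (complex_of_real (sqrt (2 * pi)))"
    by (rule tendsto_norm)
  from tendsto_divide[OF tendsto_mult[OF this tendsto_real_sqrt[OF sad(4)]] tendsto_const[of "sqrt (2 * pi)"]]
  have "(\<lambda>k. norm (sqrt (m k) * (LBINT \<theta>:{-pi..pi}. exp (\<Phi> k \<theta>)))
        * sqrt (X k * V_I \<alpha> \<beta> (s k) / m k) / sqrt (2 * pi)) \<longlonglongrightarrow> 1"
    by simp
  moreover have "\<forall>\<^sub>F k in sequentially.
      norm (sqrt (m k) * (LBINT \<theta>:{-pi..pi}. exp (\<Phi> k \<theta>))) * sqrt (X k * V_I \<alpha> \<beta> (s k) / m k) / sqrt (2 * pi)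
      = measure M {\<omega> \<in> space M. N_I Z \<alpha> \<beta> (X k) \<omega> = m k} /
            (exp (- X k * J_I \<alpha> \<beta> (m k / X k) + Re (D (of_real (s k - 1))))
              / sqrt (2 * pi * X k * V_I \<alpha> \<beta> (s k)))"
    using sad(2) X0 m0
  proof eventually_elim
    case (elim k)
    let ?s = "complex_of_real (s k)"
    let ?P = "measure M {\<omega> \<in> space M. N_I Z \<alpha> \<beta> (X k) \<omega> = m k}"
    let ?I = "LBINT \<theta>:{-pi..pi}. exp (\<Phi> k \<theta>)"
    let ?c = "X k * Re (L_I \<alpha> \<beta> (?s - 1)) + Re (D (?s - 1))"
    have s: "0 \<le> s k" "s k < r / 2" "s k \<le> 1" "- r < s k" using elim r by auto
    have pgf: "M.expectation (\<lambda>\<omega>. (?s * iexp \<theta>) ^ N_I Z \<alpha> \<beta> (X k) \<omega>) = exp (G (X k) (?s * iexp \<theta> - 1))" for \<theta>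
    proof -
      have "?s * iexp \<theta> - 1 \<in> Omega_I \<alpha> \<beta>" using circle(1)[OF s(1,2)] C_Omega by blast
      then have "exp (G (X k) (?s * iexp \<theta> - 1))
          = M.expectation (\<lambda>\<omega>. (1 + (?s * iexp \<theta> - 1)) ^ N_I Z \<alpha> \<beta> (X k) \<omega>)"
        using G(1) elim unfolding is_log_pgf_def by blast
      then show ?thesis by simp
    qed
    have "complex_of_real (2 * pi * s k ^ m k * ?P)
        = (LBINT \<theta>:{-pi..pi}. exp (G (X k) (?s * iexp \<theta> - 1)) * iexp (- (real (m k) * \<theta>)))"
      by (subst M.prob_eq_circle_integral[OF N s(1,3), symmetric]) (simp only: pgf)
    also have "\<dots> = (LBINT \<theta>:{-pi..pi}. exp (of_real (X k) * L_I \<alpha> \<beta> (?s - 1) + D (?s - 1)) * exp (\<Phi> k \<theta>))"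
      by (intro arg_cong[where f = "set_lebesgue_integral lborel {-pi..pi}"] ext)
         (simp add: \<Phi>_def exp_add[symmetric] algebra_simps)
    also have "\<dots> = exp (of_real (X k) * L_I \<alpha> \<beta> (?s - 1) + D (?s - 1)) * ?I"
      by (rule set_integral_mult_right)
    \<comment> \<open>Passing to moduli replaces \<open>L_I\<close> and \<open>D\<close> by their real parts.\<close>
    finally have "norm (complex_of_real (2 * pi * s k ^ m k * ?P))
        = norm (exp (of_real (X k) * L_I \<alpha> \<beta> (?s - 1) + D (?s - 1)) * ?I)" by (rule arg_cong)
    also have "\<dots> = exp ?c * norm ?I" by (simp add: norm_mult)
    also have "norm (complex_of_real (2 * pi * s k ^ m k * ?P)) = 2 * pi * s k ^ m k * ?P"
      using s by (simp only: norm_of_real) simp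
    finally have P: "?P = exp ?c * norm ?I / (2 * pi * s k ^ m k)"
      using elim by (simp add: field_simps)
    have "- X k * J_I \<alpha> \<beta> (m k / X k) = X k * Re (L_I \<alpha> \<beta> (?s - 1)) - m k * ln (s k)"
    proof -
      have "J_I \<alpha> \<beta> (m k / X k) = - Re (L_I \<alpha> \<beta> (- 1)) + (m k / X k * ln (s k) - A_I \<alpha> \<beta> (s k))"
        using elim by (intro J_I_eq) auto
      also have "A_I \<alpha> \<beta> (s k) = Re (L_I \<alpha> \<beta> (?s - 1)) - Re (L_I \<alpha> \<beta> (- 1))"
        by (simp add: A_I_def)
      finally show ?thesis using elim(2) by (simp only:) (simp add: field_simps)
    qed
    then have "exp (- X k * J_I \<alpha> \<beta> (m k / X k) + Re (D (of_real (s k - 1)))) = exp (?c - m k * ln (s k))"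
      by (simp add: algebra_simps)
    also have "\<dots> = exp ?c / s k ^ m k"
      using elim by (simp add: exp_diff exp_of_nat_mult)
    finally have J: "exp (- X k * J_I \<alpha> \<beta> (m k / X k) + Re (D (of_real (s k - 1)))) = exp ?c / s k ^ m k" .
    have sq: "sqrt (2 * pi * X k * V_I \<alpha> \<beta> (s k)) = sqrt (m k) * sqrt (X k * V_I \<alpha> \<beta> (s k) / m k) * sqrt (2 * pi)"
      using elim by (simp add: real_sqrt_mult[symmetric] mult_ac)
    have cancel: "a * (c * w) / w\<^sup>2 = a * c / w" if "0 < w" for a c w :: real
      using that by (simp add: power2_eq_square)
    have "?P / (exp ?c / s k ^ m k / sqrt (2 * pi * X k * V_I \<alpha> \<beta> (s k)))
        = norm ?I * sqrt (2 * pi * X k * V_I \<alpha> \<beta> (s k)) / (2 * pi)"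
      unfolding P using elim by simp
    also have "\<dots> = norm ?I * (sqrt (m k) * sqrt (X k * V_I \<alpha> \<beta> (s k) / m k)) / sqrt (2 * pi)"
      unfolding sq using cancel[of "sqrt (2 * pi)"] by simp
    finally show ?case
      unfolding J by (simp add: norm_mult mult_ac)
  qed
  ultimately show ?thesis by (rule Lim_transform_eventually)
qed

end

text \<open>
  The box is compact and, since \<open>\<alpha> > 0\<close>, stays away from the boundary of the half-plane.
\<close>

lemma measurable_N_I:
  assumes Z: "simple_point_process M upper_half_plane Z" and "0 < \<alpha>"
  shows "N_I Z \<alpha> \<beta> L \<in> measurable M (count_space UNIV)"
proof -
  let ?B = "{z. 0 \<le> Re z \<and> Re z \<le> L \<and> \<alpha> \<le> Im z \<and> Im z \<le> \<beta>}"
  have B: "?B = cbox (Complex 0 \<alpha>) (Complex L \<beta>)"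
    by (auto simp: in_cbox_complex_iff)
  have "bounded_borel_in upper_half_plane ?B"
    unfolding bounded_borel_in_def
  proof (intro conjI exI[of _ ?B])
    show "?B \<in> sets borel" "compact ?B" unfolding B by auto
    show "?B \<subseteq> upper_half_plane" using assms by (auto simp: upper_half_plane_def)
  qed simp
  then show ?thesis
    using Z unfolding simple_point_process_def N_I_def[abs_def] by blast
qed

theorem theorem1p3:
  fixes M :: "'w measure" and Z :: "'w \<Rightarrow> complex set"
    and \<alpha> \<beta> :: real and D :: "complex \<Rightarrow> complex"
    and b \<epsilon> :: "real \<Rightarrow> real"
  assumes Z: "determinantal_point_process M upper_half_plane K_H Z"
    and I: "0 < \<alpha>" "\<alpha> < \<beta>"
    and D: "is_D_I M Z \<alpha> \<beta> D"
    and b_pos: "\<And>L. 0 < L \<Longrightarrow> 0 < b L"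
    and eps_pos: "\<And>L. 0 < L \<Longrightarrow> 0 < \<epsilon> L"
    and b_lim: "filterlim b at_top at_top"
    and eps_lim: "(\<epsilon> \<longlongrightarrow> 0) at_top"
    and b_le: "\<forall>\<^sub>F L in at_top. b L \<le> \<epsilon> L * L"
  shows "uniformly_asymp (window b \<epsilon>)
           (\<lambda>L n. measure M {\<omega> \<in> space M. N_I Z \<alpha> \<beta> L \<omega> = n})
           (\<lambda>L n. exp (- L * J_I \<alpha> \<beta> (real n / L) + Re (D (of_real (saddle \<alpha> \<beta> L n - 1))))
                  / sqrt (2 * pi * L * V_I \<alpha> \<beta> (saddle \<alpha> \<beta> L n)))
       \<and> uniformly_asymp (window b \<epsilon>)
           (\<lambda>L n. saddle \<alpha> \<beta> L n)
           (\<lambda>L n. real n / (L * kappa_I \<alpha> \<beta>))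
       \<and> uniformly_asymp (window b \<epsilon>)
           (\<lambda>L n. L * V_I \<alpha> \<beta> (saddle \<alpha> \<beta> L n))
           (\<lambda>L n. real n)"
proof -
  interpret strip \<alpha> \<beta> by standard (fact I)+
  have spp: "simple_point_process M upper_half_plane Z"
    using Z unfolding determinantal_point_process_def by blast
  then have M: "prob_space M" unfolding simple_point_process_def by blast
  note N = measurable_N_I[OF spp I(1)]
  have limits: "filterlim (\<lambda>k. real (m k)) at_top sequentially" "(\<lambda>k. m k / X k) \<longlonglongrightarrow> 0"
      "\<forall>\<^sub>F k in sequentially. 0 < X k" "\<forall>\<^sub>F k in sequentially. 0 < m k"
    if X: "filterlim X at_top sequentially" and w: "\<And>k. m k \<in> window b \<epsilon> (X k)" for X m
  proof -
    have w': "b (X k) \<le> m k" "m k \<le> \<epsilon> (X k) * X k" for k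
      using w[of k] by (auto simp: window_def)
    show lim: "filterlim (\<lambda>k. real (m k)) at_top sequentially"
      by (rule filterlim_at_top_mono[OF filterlim_compose[OF b_lim X]]) (use w' in auto)
    then show "\<forall>\<^sub>F k in sequentially. 0 < m k"
      by (auto simp: filterlim_at_top_dense dest: spec[of _ 0])
    show X0: "\<forall>\<^sub>F k in sequentially. 0 < X k" using X by (simp add: filterlim_at_top_dense)
    show "(\<lambda>k. m k / X k) \<longlonglongrightarrow> 0"
    proof (rule Lim_null_comparison)
      show "\<forall>\<^sub>F k in sequentially. norm (m k / X k) \<le> \<epsilon> (X k)"
        using X0 by eventually_elim (use w' in \<open>simp add: divide_le_eq\<close>)
      show "(\<lambda>k. \<epsilon> (X k)) \<longlonglongrightarrow> 0" by (rule filterlim_compose[OF eps_lim X])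
    qed
  qed
  show ?thesis
  proof (intro conjI uniformly_asympI)
    fix X :: "nat \<Rightarrow> real" and m :: "nat \<Rightarrow> nat"
    assume X: "filterlim X at_top sequentially" and w: "\<And>k. m k \<in> window b \<epsilon> (X k)"
    note lim = limits[OF X w]
    show "(\<lambda>k. measure M {\<omega> \<in> space M. N_I Z \<alpha> \<beta> (X k) \<omega> = m k} /
            (exp (- X k * J_I \<alpha> \<beta> (m k / X k) + Re (D (of_real (saddle \<alpha> \<beta> (X k) (m k) - 1))))
              / sqrt (2 * pi * X k * V_I \<alpha> \<beta> (saddle \<alpha> \<beta> (X k) (m k))))) \<longlonglongrightarrow> 1"
      by (rule point_probability_limit[OF M N D X lim(1,2)])
    note sad = saddle_sequence[OF lim(3,4,2)]
    show "(\<lambda>k. X k * V_I \<alpha> \<beta> (saddle \<alpha> \<beta> (X k) (m k)) / m k) \<longlonglongrightarrow> 1"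
      by (rule sad(4))
    have "(\<lambda>k. kappa_I \<alpha> \<beta> / A' (saddle \<alpha> \<beta> (X k) (m k))) \<longlonglongrightarrow> kappa_I \<alpha> \<beta> / kappa_I \<alpha> \<beta>"
      using kappa_pos by (intro tendsto_intros sad(3)) simp
    moreover have "\<forall>\<^sub>F k in sequentially. kappa_I \<alpha> \<beta> / A' (saddle \<alpha> \<beta> (X k) (m k))
        = saddle \<alpha> \<beta> (X k) (m k) / (m k / (X k * kappa_I \<alpha> \<beta>))"
      using sad(2) lim(3,4)
    proof eventually_elim
      case (elim k)
      have n: "real (m k) = X k * (saddle \<alpha> \<beta> (X k) (m k) * A' (saddle \<alpha> \<beta> (X k) (m k)))"
        using elim(1,2) by simp
      then have "A' (saddle \<alpha> \<beta> (X k) (m k)) \<noteq> 0" using elim(3) by (intro notI) simp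
      moreover have "saddle \<alpha> \<beta> (X k) (m k) \<noteq> 0" "X k \<noteq> 0" using elim(1,2) by auto
      ultimately show ?case unfolding n using kappa_pos by (simp add: field_simps)
    qed
    ultimately show "(\<lambda>k. saddle \<alpha> \<beta> (X k) (m k) / (m k / (X k * kappa_I \<alpha> \<beta>))) \<longlonglongrightarrow> 1"
      using kappa_pos by (simp add: tendsto_cong)
  qed
qed

end
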